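(* Let $m>0$ and $\alpha>0$, and let $\phi(z)=\phi(0)+\lambda z$, where $\phi(0),\lambda\in\mathbb C$. Then the following are equivalent: (i) $C_\phi$ is compact on $F^2_{\alpha,m}(\mathbb C)$. (ii) $C_\phi$ is Hilbert-Schmidt on $F^2_{\alpha,m}(\mathbb C)$. (iii) $|\lambda|<1$.
   Context: For $m>0$ and $\alpha>0$, the weighted Fock space $F^2_{\alpha,m}(\mathbb C)$ is the Hilbert space of all entire functions on $\mathbb C$ that are square integrable with respect to the measure $d\mu_{\alpha,m}(z)=\frac{m\alpha^{2/m}}{2\pi\Gamma(2/m)}e^{-\alpha|z|^m}\,dA(z)$, where $dA$ is Lebesgue measure on $\mathbb C$ and $\Gamma$ is the Euler gamma function; its inner product is $\langle f,g\rangle_{\alpha,m}=\int_{\mathbb C} f\overline{g}\,d\mu_{\alpha,m}$ and its norm is $\|\cdot\|_{\alpha,m}$. For an entire function $\phi$, the composition operator is $C_\phi f=f\circ\phi$. Saying that it is compact (resp. Hilbert-Schmidt) on $F^2_{\alpha,m}(\mathbb C)$ means that it maps $F^2_{\alpha,m}(\mathbb C)$ into itself and is a compact (resp. Hilbert-Schmidt) linear operator there. *)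

theory Defs
  imports "HOL-Complex_Analysis.Complex_Analysis"
begin

definition fock_density :: "real \<Rightarrow> real \<Rightarrow> complex \<Rightarrow> real" where
  "fock_density \<alpha> m z =
     m * \<alpha> powr (2 / m) / (2 * pi * Gamma (2 / m)) * exp (- \<alpha> * cmod z powr m)"

definition fock_measure :: "real \<Rightarrow> real \<Rightarrow> complex measure" where
  "fock_measure \<alpha> m = density lborel (\<lambda>z. ennreal (fock_density \<alpha> m z))"

definition fock_space :: "real \<Rightarrow> real \<Rightarrow> (complex \<Rightarrow> complex) set" where
  "fock_space \<alpha> m =
     {f. f holomorphic_on UNIV \<and> integrable (fock_measure \<alpha> m) (\<lambda>z. (cmod (f z))\<^sup>2)}"

definition fock_inner ::
    "real \<Rightarrow> real \<Rightarrow> (complex \<Rightarrow> complex) \<Rightarrow> (complex \<Rightarrow> complex) \<Rightarrow> complex" where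
  "fock_inner \<alpha> m f g = (LINT z|fock_measure \<alpha> m. f z * cnj (g z))"

definition fock_norm :: "real \<Rightarrow> real \<Rightarrow> (complex \<Rightarrow> complex) \<Rightarrow> real" where
  "fock_norm \<alpha> m f = sqrt (Re (fock_inner \<alpha> m f f))"

definition fock_dist ::
    "real \<Rightarrow> real \<Rightarrow> (complex \<Rightarrow> complex) \<Rightarrow> (complex \<Rightarrow> complex) \<Rightarrow> real" where
  "fock_dist \<alpha> m f g = fock_norm \<alpha> m (\<lambda>z. f z - g z)"

text \<open>The norm topology. \<open>Metric_space.mtopology\<close> is meaningful only for a metric;
  \<open>fock_Metric_space\<close> below shows that \<open>fock_dist\<close> is one.\<close>

definition fock_topology :: "real \<Rightarrow> real \<Rightarrow> (complex \<Rightarrow> complex) topology" where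
  "fock_topology \<alpha> m = Metric_space.mtopology (fock_space \<alpha> m) (fock_dist \<alpha> m)"

definition fock_linear_operator ::
    "real \<Rightarrow> real \<Rightarrow> ((complex \<Rightarrow> complex) \<Rightarrow> complex \<Rightarrow> complex) \<Rightarrow> bool" where
  "fock_linear_operator \<alpha> m T \<longleftrightarrow>
     T ` fock_space \<alpha> m \<subseteq> fock_space \<alpha> m \<and>
     (\<forall>f\<in>fock_space \<alpha> m. \<forall>g\<in>fock_space \<alpha> m. \<forall>a b.
        T (\<lambda>z. a * f z + b * g z) = (\<lambda>z. a * T f z + b * T g z))"

text \<open>Compactness: the image of the closed unit ball is relatively compact.\<close>

definition fock_compact_operator ::
    "real \<Rightarrow> real \<Rightarrow> ((complex \<Rightarrow> complex) \<Rightarrow> complex \<Rightarrow> complex) \<Rightarrow> bool" where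
  "fock_compact_operator \<alpha> m T \<longleftrightarrow>
     fock_linear_operator \<alpha> m T \<and>
     compactin (fock_topology \<alpha> m)
       (fock_topology \<alpha> m closure_of (T ` {f \<in> fock_space \<alpha> m. fock_norm \<alpha> m f \<le> 1}))"

text \<open>A Hilbert space basis is a maximal orthonormal set.\<close>

definition fock_orthonormal_basis :: "real \<Rightarrow> real \<Rightarrow> (complex \<Rightarrow> complex) set \<Rightarrow> bool" where
  "fock_orthonormal_basis \<alpha> m B \<longleftrightarrow>
     B \<subseteq> fock_space \<alpha> m \<and>
     (\<forall>e\<in>B. \<forall>e'\<in>B. fock_inner \<alpha> m e e' = (if e = e' then 1 else 0)) \<and>
     (\<forall>f\<in>fock_space \<alpha> m. (\<forall>e\<in>B. fock_inner \<alpha> m f e = 0) \<longrightarrow> f = (\<lambda>z. 0))"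

definition fock_Hilbert_Schmidt_operator ::
    "real \<Rightarrow> real \<Rightarrow> ((complex \<Rightarrow> complex) \<Rightarrow> complex \<Rightarrow> complex) \<Rightarrow> bool" where
  "fock_Hilbert_Schmidt_operator \<alpha> m T \<longleftrightarrow>
     fock_linear_operator \<alpha> m T \<and>
     (\<exists>B. fock_orthonormal_basis \<alpha> m B \<and> (\<lambda>e. (fock_norm \<alpha> m (T e))\<^sup>2) summable_on B)"

definition composition_operator ::
    "(complex \<Rightarrow> complex) \<Rightarrow> (complex \<Rightarrow> complex) \<Rightarrow> complex \<Rightarrow> complex" where
  "composition_operator \<phi> f = f \<circ> \<phi>"

lemma fock_density_pos: "m > 0 \<Longrightarrow> \<alpha> > 0 \<Longrightarrow> fock_density \<alpha> m z > 0"
  unfolding fock_density_def by (intro mult_pos_pos divide_pos_pos Gamma_real_pos) auto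

lemma fock_density_borel [measurable]: "fock_density \<alpha> m \<in> borel_measurable borel"
  unfolding fock_density_def[abs_def] by measurable

lemma sets_fock_measure [measurable_cong]: "sets (fock_measure \<alpha> m) = sets borel"
  by (simp add: fock_measure_def)

lemma fock_norm_eq: "fock_norm \<alpha> m f = sqrt (LINT z|fock_measure \<alpha> m. (cmod (f z))\<^sup>2)"
proof -
  have "fock_inner \<alpha> m f f = (LINT z|fock_measure \<alpha> m. complex_of_real ((cmod (f z))\<^sup>2))"
    unfolding fock_inner_def by (simp only: complex_norm_square)
  also have "\<dots> = complex_of_real (LINT z|fock_measure \<alpha> m. (cmod (f z))\<^sup>2)"
    by (rule integral_complex_of_real)
  finally show ?thesis by (simp add: fock_norm_def)
qed

lemma fock_norm_nonneg: "0 \<le> fock_norm \<alpha> m f"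
  by (simp add: fock_norm_eq)

lemma fock_norm_square: "(fock_norm \<alpha> m f)\<^sup>2 = (LINT z|fock_measure \<alpha> m. (cmod (f z))\<^sup>2)"
  by (simp add: fock_norm_eq)

lemma fock_space_measurable:
  assumes "f \<in> fock_space \<alpha> m"
  shows "f \<in> borel_measurable borel"
  using assms
  by (auto simp: fock_space_def intro!: borel_measurable_continuous_onI holomorphic_on_imp_continuous_on)

lemma fock_norm_zero_iff:
  assumes "m > 0" "\<alpha> > 0" and f: "f \<in> fock_space \<alpha> m"
  shows "fock_norm \<alpha> m f = 0 \<longleftrightarrow> f = (\<lambda>z. 0)"
proof
  assume "fock_norm \<alpha> m f = 0"
  then have "(LINT z|fock_measure \<alpha> m. (cmod (f z))\<^sup>2) = 0"
    by (simp add: fock_norm_eq)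
  then have "AE z in fock_measure \<alpha> m. (cmod (f z))\<^sup>2 = 0"
    using f by (subst (asm) integral_nonneg_eq_0_iff_AE) (auto simp: fock_space_def)
  then have "AE z in lborel. f z = 0"
    unfolding fock_measure_def
    using fock_density_pos[OF assms(1,2)] by (subst (asm) AE_density) auto
  then have ae: "AE z in lebesgue. z \<in> {z. f z = 0}"
    by (auto intro: AE_completion)
  have "closed {z. f z = 0}"
    using f by (intro closed_Collect_eq)
      (auto simp: fock_space_def intro: holomorphic_on_imp_continuous_on)
  then show "f = (\<lambda>z. 0)"
    using mem_closed_if_AE_lebesgue[OF _ ae] by auto
qed (simp add: fock_norm_eq)

lemma cmod_add_square_le:
  fixes t :: real
  assumes "t > 0"
  shows "(cmod (a + b))\<^sup>2 \<le> (1 + t) * (cmod a)\<^sup>2 + (1 + 1 / t) * (cmod b)\<^sup>2"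
proof -
  define x y where "x = cmod a" and "y = cmod b"
  have "0 \<le> (t * x - y)\<^sup>2 / t" using assms by simp
  also have "\<dots> = t * x\<^sup>2 + y\<^sup>2 / t - 2 * x * y"
    using assms by (simp add: field_simps power2_eq_square)
  finally have "(x + y)\<^sup>2 \<le> (1 + t) * x\<^sup>2 + (1 + 1 / t) * y\<^sup>2"
    by (simp add: algebra_simps power2_eq_square)
  moreover have "(cmod (a + b))\<^sup>2 \<le> (x + y)\<^sup>2"
    unfolding x_def y_def by (intro power_mono norm_triangle_ineq) auto
  ultimately show ?thesis unfolding x_def y_def by linarith
qed

lemma fock_space_add:
  assumes f: "f \<in> fock_space \<alpha> m" and g: "g \<in> fock_space \<alpha> m"
  shows "(\<lambda>z. f z + g z) \<in> fock_space \<alpha> m"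
proof -
  note [measurable] = fock_space_measurable[OF f] fock_space_measurable[OF g]
  have "integrable (fock_measure \<alpha> m) (\<lambda>z. 2 * (cmod (f z))\<^sup>2 + 2 * (cmod (g z))\<^sup>2)"
    using f g by (auto simp: fock_space_def)
  then have "integrable (fock_measure \<alpha> m) (\<lambda>z. (cmod (f z + g z))\<^sup>2)"
    by (rule Bochner_Integration.integrable_bound)
      (use cmod_add_square_le[of 1] in auto)
  then show ?thesis
    using f g by (auto simp: fock_space_def intro: holomorphic_intros)
qed

lemma fock_space_cmult:
  assumes "f \<in> fock_space \<alpha> m"
  shows "(\<lambda>z. c * f z) \<in> fock_space \<alpha> m"
  using assms by (auto simp: fock_space_def norm_mult power_mult_distrib intro: holomorphic_intros)

lemma fock_space_diff:
  assumes "f \<in> fock_space \<alpha> m" "g \<in> fock_space \<alpha> m"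
  shows "(\<lambda>z. f z - g z) \<in> fock_space \<alpha> m"
  using fock_space_add[OF assms(1) fock_space_cmult[OF assms(2), of "-1"]] by simp

lemma fock_norm_triangle:
  assumes "m > 0" "\<alpha> > 0" and f: "f \<in> fock_space \<alpha> m" and g: "g \<in> fock_space \<alpha> m"
  shows "fock_norm \<alpha> m (\<lambda>z. f z + g z) \<le> fock_norm \<alpha> m f + fock_norm \<alpha> m g"
proof (cases "fock_norm \<alpha> m f = 0 \<or> fock_norm \<alpha> m g = 0")
  case True
  then have "f = (\<lambda>z. 0) \<or> g = (\<lambda>z. 0)"
    using assms fock_norm_zero_iff by blast
  then show ?thesis by (auto simp: fock_norm_nonneg)
next
  case False
  define a b where "a = fock_norm \<alpha> m f" and "b = fock_norm \<alpha> m g"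
  have pos: "a > 0" "b > 0"
    using False fock_norm_nonneg[of \<alpha> m f] fock_norm_nonneg[of \<alpha> m g] by (auto simp: a_def b_def)
  have int: "integrable (fock_measure \<alpha> m) (\<lambda>z. (cmod (f z))\<^sup>2)"
    "integrable (fock_measure \<alpha> m) (\<lambda>z. (cmod (g z))\<^sup>2)"
    "integrable (fock_measure \<alpha> m) (\<lambda>z. (cmod (f z + g z))\<^sup>2)"
    using f g fock_space_add[OF f g] by (auto simp: fock_space_def)
  have "(fock_norm \<alpha> m (\<lambda>z. f z + g z))\<^sup>2
      \<le> (LINT z|fock_measure \<alpha> m. (1 + b / a) * (cmod (f z))\<^sup>2 + (1 + 1 / (b / a)) * (cmod (g z))\<^sup>2)"
    unfolding fock_norm_square
    by (intro integral_mono int Bochner_Integration.integrable_add integrable_mult_right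
        cmod_add_square_le) (use pos in auto)
  also have "\<dots> = (1 + b / a) * a\<^sup>2 + (1 + 1 / (b / a)) * b\<^sup>2"
    using int unfolding a_def b_def fock_norm_square by simp
  also have "\<dots> = (a + b)\<^sup>2"
    using pos by (simp add: field_simps power2_eq_square)
  finally show ?thesis
    unfolding a_def[symmetric] b_def[symmetric] by (rule power2_le_imp_le) (use pos in simp)
qed

lemma fock_Metric_space:
  assumes "m > 0" "\<alpha> > 0"
  shows "Metric_space (fock_space \<alpha> m) (fock_dist \<alpha> m)"
proof
  show "0 \<le> fock_dist \<alpha> m f g" for f g
    by (simp add: fock_dist_def fock_norm_nonneg)
  show "fock_dist \<alpha> m f g = fock_dist \<alpha> m g f" for f g
    by (simp add: fock_dist_def fock_norm_eq norm_minus_commute)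
  show "fock_dist \<alpha> m f g = 0 \<longleftrightarrow> f = g"
    if "f \<in> fock_space \<alpha> m" "g \<in> fock_space \<alpha> m" for f g
    using fock_norm_zero_iff[OF assms fock_space_diff[OF that]]
    by (simp add: fock_dist_def fun_eq_iff)
  show "fock_dist \<alpha> m f h \<le> fock_dist \<alpha> m f g + fock_dist \<alpha> m g h"
    if "f \<in> fock_space \<alpha> m" "g \<in> fock_space \<alpha> m" "h \<in> fock_space \<alpha> m" for f g h
    using fock_norm_triangle[OF assms fock_space_diff[OF that(1,2)] fock_space_diff[OF that(2,3)]]
    by (simp add: fock_dist_def)
qed

end

theory Submission
  imports Defs "HOL-Real_Asymp.Real_Asymp"
begin

text \<open>Write \<open>\<rho>\<close> for the radial density, \<open>H\<close> for the space, \<open>\<phi> z = b + c z\<close>, and \<open>e\<^sub>n\<close> for the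
  normalised monomial \<open>z\<^sup>n / \<parallel>z\<^sup>n\<parallel>\<close> (\<open>unit_monomial n\<close> in the code).

  Rotation invariance of the measure replaces polar coordinates throughout. Integrating the power
  series of an entire \<open>f\<close> against \<open>z\<^sup>n\<close> over a disc leaves only the \<open>n\<close>-th Taylor coefficient
  (\<open>disc_integral_against_monomial\<close>). For Lebesgue measure this is the area mean value property, so
  that point evaluations are bounded on \<open>H\<close>, uniformly on compact sets; for the Fock measure it says
  that the \<open>e\<^sub>n\<close> form an orthonormal basis.

  Let \<open>|c| < 1\<close>. Far out, \<open>|b + c z| \<le> q |z|\<close> with some \<open>q < 1\<close>, so \<open>\<rho> z / \<rho> (\<phi> z)\<close> tends to zero.
  Changing variables, the norm of \<open>f \<circ> \<phi>\<close> is controlled by the values of \<open>f\<close> on a compact set and an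
  arbitrarily small multiple of the norm of \<open>f\<close> (\<open>composition_norm_estimate\<close>). Since by Montel's
  theorem and Fatou's lemma bounded sequences in \<open>H\<close> have locally uniformly convergent subsequences
  with limit in \<open>H\<close>, the image of the unit ball is sequentially compact. The same contraction bounds
  \<open>\<parallel>e\<^sub>n \<circ> \<phi>\<parallel>\<^sup>2\<close> by a geometric sequence, which gives the Hilbert-Schmidt property.

  Let \<open>|c| \<ge> 1\<close>. The leading coefficient of \<open>e\<^sub>n \<circ> \<phi>\<close> gives \<open>\<parallel>e\<^sub>n \<circ> \<phi>\<parallel> \<ge> |c|\<^sup>n \<ge> 1\<close>, while \<open>e\<^sub>n \<circ> \<phi>\<close> tends
  to zero pointwise. A norm limit of a subsequence would have to vanish, so the operator is not
  compact. For the Hilbert-Schmidt case let \<open>B\<close> be any orthonormal basis. Expanding the elements of \<open>H\<close>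
  in \<open>B\<close> shows that \<open>\<Sum>n<N. |e\<^sub>n w|\<^sup>2\<close> is at most \<open>\<Sum>u\<in>B. |u w|\<^sup>2\<close>, the value of the
  reproducing kernel on the diagonal. Putting \<open>w = \<phi> z\<close> and integrating, \<open>N \<le> \<Sum>u\<in>B. \<parallel>u \<circ> \<phi>\<parallel>\<^sup>2\<close> for every \<open>N\<close>.\<close>

section \<open>Changes of variables in the plane\<close>

lemma borel_measurable_cnj [measurable]: "cnj \<in> borel_measurable borel"
  by (intro borel_measurable_continuous_onI continuous_intros)

lemma holomorphic_on_affine_argument:
  assumes "f holomorphic_on UNIV"
  shows "(\<lambda>z. f (b + c * z)) holomorphic_on UNIV"
proof -
  have "(\<lambda>z. b + c * z) holomorphic_on UNIV" by (intro holomorphic_intros)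
  from holomorphic_on_compose_gen[OF this assms] show ?thesis by (simp add: o_def)
qed

lemma nn_integral_lborel_translate:
  fixes g :: "complex \<Rightarrow> ennreal"
  assumes [measurable]: "g \<in> borel_measurable borel"
  shows "(\<integral>\<^sup>+z. g (b + z) \<partial>lborel) = (\<integral>\<^sup>+z. g z \<partial>lborel)"
proof -
  have "(\<integral>\<^sup>+z. g z \<partial>lborel) = (\<integral>\<^sup>+z. g z \<partial>distr lborel borel ((+) b))"
    by (simp add: lborel_distr_plus)
  also have "\<dots> = (\<integral>\<^sup>+z. g (b + z) \<partial>lborel)"
    by (rule nn_integral_distr) simp_all
  finally show ?thesis by simp
qed

text \<open>Both sides, multiplied by the area \<open>\<pi>\<close> of the unit disc \<open>B\<close>, equal the double integral of
  \<open>1\<^sub>B y \<cdot> g (y + c x)\<close>: integrating over \<open>x\<close> first and translating recovers the left side, while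
  translating \<open>y\<close> by \<open>- c x\<close> turns the \<open>x\<close>-integral into the area of a disc of radius \<open>1 / |c|\<close>. This
  is the argument for uniqueness of Haar measure; it needs only that discs have the expected area.\<close>

lemma nn_integral_lborel_complex_mult:
  fixes g :: "complex \<Rightarrow> ennreal" and c :: complex
  assumes [measurable]: "g \<in> borel_measurable borel" and "c \<noteq> 0"
  shows "(\<integral>\<^sup>+z. g (c * z) \<partial>lborel) = ennreal (1 / (cmod c)\<^sup>2) * (\<integral>\<^sup>+z. g z \<partial>lborel)"
proof -
  define B :: "complex set" where "B = ball 0 1"
  have [measurable]: "B \<in> sets borel" unfolding B_def by simp
  have area: "emeasure lborel (ball z r :: complex set) = ennreal (pi * r\<^sup>2)" if "r \<ge> 0" for z r
    using that by (simp add: emeasure_ball unit_ball_vol_2 power2_eq_square)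
  have "ennreal pi * (\<integral>\<^sup>+x. g (c * x) \<partial>lborel)
      = (\<integral>\<^sup>+y. indicator B y * (\<integral>\<^sup>+x. g (c * x) \<partial>lborel) \<partial>lborel)"
    using area[of 1 0] by (subst nn_integral_multc) (auto simp flip: B_def)
  also have "\<dots> = (\<integral>\<^sup>+y. indicator B y * (\<integral>\<^sup>+x. g (c * (y / c + x)) \<partial>lborel) \<partial>lborel)"
    by (subst nn_integral_lborel_translate[where g = "\<lambda>x. g (c * x)"]) simp_all
  also have "\<dots> = (\<integral>\<^sup>+y. (\<integral>\<^sup>+x. indicator B y * g (y + c * x) \<partial>lborel) \<partial>lborel)"
    using \<open>c \<noteq> 0\<close> by (subst nn_integral_cmult) (simp_all add: distrib_left)
  also have "\<dots> = (\<integral>\<^sup>+x. (\<integral>\<^sup>+y. indicator B y * g (y + c * x) \<partial>lborel) \<partial>lborel)"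
    by (rule lborel_pair.Fubini') simp
  also have "\<dots> = (\<integral>\<^sup>+x. (\<integral>\<^sup>+y. indicator B (y - c * x) * g y \<partial>lborel) \<partial>lborel)"
  proof (rule nn_integral_cong)
    fix x
    show "(\<integral>\<^sup>+y. indicator B y * g (y + c * x) \<partial>lborel) = (\<integral>\<^sup>+y. indicator B (y - c * x) * g y \<partial>lborel)"
      using nn_integral_lborel_translate[where b = "c * x" and g = "\<lambda>y. indicator B (y - c * x) * g y"]
      by (simp add: add.commute)
  qed
  also have "\<dots> = (\<integral>\<^sup>+y. (\<integral>\<^sup>+x. indicator B (y - c * x) * g y \<partial>lborel) \<partial>lborel)"
    by (rule lborel_pair.Fubini') simp
  also have "\<dots> = (\<integral>\<^sup>+y. ennreal (pi / (cmod c)\<^sup>2) * g y \<partial>lborel)"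
  proof (rule nn_integral_cong)
    fix y
    have "indicator B (y - c * x) = (indicator (ball (y / c) (1 / cmod c)) x :: ennreal)" for x
    proof -
      have "y - c * x = c * (y / c - x)" using \<open>c \<noteq> 0\<close> by (simp add: algebra_simps)
      then have "cmod (y - c * x) = cmod c * dist (y / c) x" by (metis dist_norm norm_mult)
      then show ?thesis using \<open>c \<noteq> 0\<close> by (simp add: B_def indicator_def field_simps)
    qed
    then have "(\<integral>\<^sup>+x. indicator B (y - c * x) * g y \<partial>lborel)
        = emeasure lborel (ball (y / c) (1 / cmod c)) * g y"
      by (simp only:) (subst nn_integral_multc; auto intro!: borel_measurable_indicator)
    then show "(\<integral>\<^sup>+x. indicator B (y - c * x) * g y \<partial>lborel) = ennreal (pi / (cmod c)\<^sup>2) * g y"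
      by (simp add: area power_divide)
  qed
  also have "\<dots> = ennreal pi * (ennreal (1 / (cmod c)\<^sup>2) * (\<integral>\<^sup>+z. g z \<partial>lborel))"
    by (simp add: nn_integral_cmult mult.assoc[symmetric] ennreal_mult[symmetric])
  finally show ?thesis
    by (simp add: ennreal_mult_cancel_left)
qed

lemma nn_integral_lborel_complex_affine:
  fixes g :: "complex \<Rightarrow> ennreal" and c :: complex
  assumes [measurable]: "g \<in> borel_measurable borel" and "c \<noteq> 0"
  shows "(\<integral>\<^sup>+z. g (b + c * z) \<partial>lborel) = ennreal (1 / (cmod c)\<^sup>2) * (\<integral>\<^sup>+z. g z \<partial>lborel)"
  using nn_integral_lborel_complex_mult[where g = "\<lambda>z. g (b + z)" and c = c] assms(2)
  by (simp add: nn_integral_lborel_translate)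

section \<open>Rotation invariant measures\<close>

definition rotation_invariant :: "complex measure \<Rightarrow> bool" where
  "rotation_invariant N \<longleftrightarrow>
     sets N = sets borel \<and> (\<forall>w. cmod w = 1 \<longrightarrow> distr N borel (\<lambda>z. w * z) = N)"

lemma rotation_invariant_radial_density:
  assumes [measurable]: "\<rho> \<in> borel_measurable borel"
    and radial: "\<And>w z. cmod w = 1 \<Longrightarrow> \<rho> (w * z) = \<rho> z"
  shows "rotation_invariant (density lborel \<rho>)"
  unfolding rotation_invariant_def
proof (intro conjI allI impI)
  fix w :: complex assume w: "cmod w = 1"
  show "distr (density lborel \<rho>) borel (\<lambda>z. w * z) = density lborel \<rho>"
  proof (rule measure_eqI)
    fix A assume "A \<in> sets (distr (density lborel \<rho>) borel (\<lambda>z. w * z))"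
    then have A[measurable]: "A \<in> sets borel" by simp
    have "emeasure (distr (density lborel \<rho>) borel (\<lambda>z. w * z)) A
        = (\<integral>\<^sup>+z. \<rho> (w * z) * indicator A (w * z) \<partial>lborel)"
      using measurable_sets[of "\<lambda>z. w * z" borel borel A]
      by (subst emeasure_distr; (subst emeasure_density)?)
        (auto simp: radial[OF w] indicator_def intro!: nn_integral_cong)
    also have "\<dots> = (\<integral>\<^sup>+z. \<rho> z * indicator A z \<partial>lborel)"
      using w by (subst nn_integral_lborel_complex_mult[where g = "\<lambda>z. \<rho> z * indicator A z"]) auto
    finally show "emeasure (distr (density lborel \<rho>) borel (\<lambda>z. w * z)) A = emeasure (density lborel \<rho>) A"
      by (simp add: emeasure_density)
  qed simp
qed simp

lemma rotation_invariant_lborel: "rotation_invariant lborel"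
  using rotation_invariant_radial_density[of "\<lambda>_. 1"] by (simp add: density_1)

text \<open>A rotation by the angle \<open>\<pi> / (n - k)\<close> preserves the integral and changes the sign of the integrand.\<close>

lemma rotation_invariant_orthogonal:
  assumes N: "rotation_invariant N" and [measurable]: "h \<in> borel_measurable borel"
    and radial: "\<And>w z. cmod w = 1 \<Longrightarrow> h (w * z) = h z" and "n \<noteq> k"
  shows "(LINT z|N. h z * (z ^ n * cnj (z ^ k))) = (0::complex)"
proof -
  have [measurable_cong]: "sets N = sets borel" using N by (simp add: rotation_invariant_def)
  define w where "w = cis (pi / (real n - real k))"
  have w: "cmod w = 1" by (simp add: w_def)
  have "w ^ n * cnj (w ^ k) = cis (real n * (pi / (real n - real k)) - real k * (pi / (real n - real k)))"
    by (simp add: w_def Complex.DeMoivre cis_mult cis_cnj)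
  also have "real n * (pi / (real n - real k)) - real k * (pi / (real n - real k)) = pi"
    using \<open>n \<noteq> k\<close> by (simp flip: diff_divide_distrib left_diff_distrib)
  finally have w': "w ^ n * cnj (w ^ k) = -1" by simp
  have "(LINT z|N. h z * (z ^ n * cnj (z ^ k)))
      = (LINT z|distr N borel (\<lambda>z. w * z). h z * (z ^ n * cnj (z ^ k)))"
    using N w by (simp add: rotation_invariant_def)
  also have "\<dots> = (LINT z|N. h (w * z) * ((w * z) ^ n * cnj ((w * z) ^ k)))"
    by (rule integral_distr) simp_all
  also have "\<dots> = (LINT z|N. (w ^ n * cnj (w ^ k)) * (h z * (z ^ n * cnj (z ^ k))))"
    by (simp only: radial[OF w] power_mult_distrib complex_cnj_mult) (simp only: mult_ac)
  also have "\<dots> = - (LINT z|N. h z * (z ^ n * cnj (z ^ k)))"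
    by (simp only: w' mult_minus1 integral_minus)
  finally show ?thesis by simp
qed

text \<open>On the disc the power series of \<open>f\<close> converges uniformly and absolutely, so it may be integrated term
  by term; all terms but the \<open>n\<close>-th vanish by orthogonality.\<close>

lemma disc_integral_against_monomial:
  assumes N: "rotation_invariant N" and fin: "emeasure N (cball 0 R) < \<infinity>"
    and f: "f holomorphic_on UNIV" and R: "R \<ge> 0"
  shows "(LINT z|N. indicator (cball 0 R) z * (f z * cnj (z ^ n)))
       = (deriv ^^ n) f 0 / fact n * (LINT z|N. indicator (cball 0 R) z * (z ^ n * cnj (z ^ n)))"
proof -
  have s[measurable_cong]: "sets N = sets borel" using N by (simp add: rotation_invariant_def)
  define a where "a k = (deriv ^^ k) f 0 / fact k" for k
  define \<theta> :: "complex \<Rightarrow> complex" where "\<theta> = indicator (cball 0 R)"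
  have [measurable]: "\<theta> \<in> borel_measurable borel" unfolding \<theta>_def by (intro borel_measurable_indicator) simp
  define F where "F k z = a k * (\<theta> z * (z ^ k * cnj (z ^ n)))" for k z
  have ser: "(\<lambda>k. a k * z ^ k) sums f z" for z
    using holomorphic_power_series[of f 0 "cmod z + 1" z] f holomorphic_on_subset
    by (auto simp: a_def)
  have abs: "summable (\<lambda>k. cmod (a k) * R ^ k)"
  proof -
    have "summable (\<lambda>k. cmod (a k * of_real R ^ k))"
      by (rule powser_insidea[of _ "of_real (R + 1)"]) (use ser sums_summable R in auto)
    then show ?thesis using R by (simp add: norm_mult norm_power)
  qed
  have bound: "cmod (F k z) \<le> cmod (a k) * R ^ k * (R ^ n * indicator (cball 0 R) z)" for k z
    by (auto simp: F_def \<theta>_def indicator_def norm_mult norm_power mult.assoc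
        intro!: mult_mono mult_left_mono power_mono zero_le_power R)
  have intb: "integrable N (\<lambda>z. R ^ n * indicator (cball 0 R) z :: real)"
    using fin by (intro integrable_mult_right integrable_real_indicator) (auto simp: s)
  have [measurable]: "F k \<in> borel_measurable N" for k unfolding F_def by simp
  have intF: "integrable N (F k)" for k
    by (rule Bochner_Integration.integrable_bound[OF integrable_mult_right[OF intb, of "cmod (a k) * R ^ k"]])
      (use bound R in \<open>auto intro!: AE_I2 order.trans[OF bound]\<close>)
  have "(\<lambda>k. LINT z|N. F k z) sums (LINT z|N. (\<Sum>k. F k z))"
  proof (rule sums_integral[OF intF])
    show "AE z in N. summable (\<lambda>k. cmod (F k z))"
      by (rule AE_I2, rule summable_comparison_test'[OF summable_mult2[OF abs]])
        (use bound in auto)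
    have "(LINT z|N. cmod (F k z)) \<le> cmod (a k) * R ^ k * (LINT z|N. R ^ n * indicator (cball 0 R) z)" for k
      by (subst integral_mult_right_zero[symmetric], rule integral_mono)
        (use intF intb bound in auto)
    then show "summable (\<lambda>k. LINT z|N. cmod (F k z))"
      by (intro summable_comparison_test'[OF summable_mult2[OF abs]]) auto
  qed
  moreover have "(\<Sum>k. F k z) = \<theta> z * (f z * cnj (z ^ n))" for z
  proof -
    have "(\<lambda>k. (a k * z ^ k) * (\<theta> z * cnj (z ^ n))) sums (f z * (\<theta> z * cnj (z ^ n)))"
      by (intro sums_mult2 ser)
    then show ?thesis by (simp add: F_def mult_ac sums_iff)
  qed
  moreover have "(LINT z|N. F k z) = (if k = n then a n * (LINT z|N. \<theta> z * (z ^ n * cnj (z ^ n))) else 0)" for k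
  proof (cases "k = n")
    case False
    have "(LINT z|N. \<theta> z * (z ^ k * cnj (z ^ n))) = 0"
      by (rule rotation_invariant_orthogonal[OF N _ _ False]) (auto simp: \<theta>_def indicator_def norm_mult)
    then show ?thesis using False by (simp only: F_def integral_mult_right_zero) simp
  qed (simp add: F_def)
  ultimately have "(\<lambda>k. if k = n then a n * (LINT z|N. \<theta> z * (z ^ n * cnj (z ^ n))) else 0)
      sums (LINT z|N. \<theta> z * (f z * cnj (z ^ n)))"
    by simp
  moreover have "(\<lambda>k. if k = n then a n * (LINT z|N. \<theta> z * (z ^ n * cnj (z ^ n))) else 0)
      sums (a n * (LINT z|N. \<theta> z * (z ^ n * cnj (z ^ n))))"
    by (rule sums_single)
  ultimately show ?thesis
    unfolding \<theta>_def a_def by (rule sums_unique2)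
qed

text \<open>The case \<open>n = 0\<close> of the preceding lemma, for Lebesgue measure and the translate of \<open>f\<close> by \<open>w\<close>.\<close>

lemma area_mean_value:
  assumes f: "f holomorphic_on UNIV"
  shows "of_real pi * f w = (LINT z|lborel. indicator (cball 0 1) z * f (w + z))"
proof -
  have fin: "emeasure lborel (cball 0 1 :: complex set) = ennreal pi"
    by (simp add: emeasure_cball unit_ball_vol_2)
  have "(\<lambda>z. f (w + z)) holomorphic_on UNIV"
    using holomorphic_on_affine_argument[OF f, of w 1] by simp
  from disc_integral_against_monomial[OF rotation_invariant_lborel _ this, of 1 0] fin
  have "(LINT z|lborel. indicator (cball 0 1) z * f (w + z))
      = f w * (LINT z|lborel. indicator (cball (0::complex) 1) z)"
    by simp
  also have "(LINT z|lborel. indicator (cball (0::complex) 1) z)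
      = (LINT z|lborel. complex_of_real (indicator (cball (0::complex) 1) z))"
    by (simp only: of_real_indicator)
  also have "\<dots> = of_real (LINT z|lborel. indicator (cball (0::complex) 1) z)"
    by (rule integral_complex_of_real)
  also have "(LINT z|lborel. indicator (cball (0::complex) 1) z) = pi"
    using fin by (simp add: measure_def)
  finally show ?thesis by (simp add: mult.commute)
qed

section \<open>The Fock measure and its monomials\<close>

text \<open>The fourth power makes the bound summable over the unit annuli of the plane, whose enclosing discs
  have area of quadratic growth.\<close>

lemma power_times_exp_decay:
  fixes \<alpha> m :: real
  assumes "m > 0" "\<alpha> > 0"
  obtains C where "C \<ge> 0" "\<And>x. x \<ge> 0 \<Longrightarrow> x ^ k * exp (- \<alpha> * x powr m) \<le> C / (1 + x) ^ 4"
proof -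
  have "((\<lambda>x. (1 + x) powr (4 + real k) * exp (- \<alpha> * x powr m)) \<longlongrightarrow> 0) at_top"
    using assms by real_asymp
  then have "\<forall>\<^sub>F x in at_top. (1 + x) powr (4 + real k) * exp (- \<alpha> * x powr m) < 1"
    by (rule order_tendstoD) simp
  then obtain X where X: "\<And>x. x \<ge> X \<Longrightarrow> (1 + x) powr (4 + real k) * exp (- \<alpha> * x powr m) < 1"
    by (auto simp: eventually_at_top_linorder)
  define C where "C = 1 + (1 + \<bar>X\<bar>) ^ (4 + k)"
  have "x ^ k * exp (- \<alpha> * x powr m) \<le> C / (1 + x) ^ 4" if "x \<ge> 0" for x
  proof -
    have "(1 + x) ^ 4 * (x ^ k * exp (- \<alpha> * x powr m)) \<le> (1 + x) ^ (4 + k) * exp (- \<alpha> * x powr m)"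
      using that by (auto simp: power_add intro!: mult_left_mono mult_right_mono power_mono)
    also have "\<dots> \<le> C"
    proof (cases "x \<ge> X")
      case True
      have "(1 + x) ^ (4 + k) = (1 + x) powr (4 + real k)"
        using that powr_realpow[of "1 + x" "4 + k"] by simp
      then show ?thesis using X[OF True] by (simp add: C_def add_increasing2)
    next
      case False
      then have "(1 + x) ^ (4 + k) * exp (- \<alpha> * x powr m) \<le> (1 + \<bar>X\<bar>) ^ (4 + k) * 1"
        using that assms by (intro mult_mono power_mono) auto
      then show ?thesis by (simp add: C_def)
    qed
    finally show ?thesis using that by (simp add: pos_le_divide_eq mult.commute)
  qed
  moreover have "C \<ge> 0" by (simp add: C_def)
  ultimately show thesis using that by blast
qed

locale fock_parameters =
  fixes \<alpha> m :: real
  assumes m_pos: "m > 0" and alpha_pos: "\<alpha> > 0"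
begin

abbreviation "\<mu> \<equiv> fock_measure \<alpha> m"
abbreviation "\<rho> \<equiv> fock_density \<alpha> m"
abbreviation "H \<equiv> fock_space \<alpha> m"
abbreviation "ip \<equiv> fock_inner \<alpha> m"
abbreviation "nrm \<equiv> fock_norm \<alpha> m"

lemma rho_pos: "\<rho> z > 0"
  using fock_density_pos[OF m_pos alpha_pos] .

lemma rho_eq: "\<rho> z = \<rho> 0 * exp (- \<alpha> * cmod z powr m)"
  using m_pos by (simp add: fock_density_def)

lemma rho_antimono: "cmod z \<le> cmod w \<Longrightarrow> \<rho> w \<le> \<rho> z"
  using rho_pos[of 0] m_pos alpha_pos
  by (subst (1 2) rho_eq) (auto intro!: mult_left_mono powr_mono2)

lemma nn_integral_fock:
  assumes [measurable]: "g \<in> borel_measurable borel"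
  shows "(\<integral>\<^sup>+z. g z \<partial>\<mu>) = (\<integral>\<^sup>+z. ennreal (\<rho> z) * g z \<partial>lborel)"
  unfolding fock_measure_def by (rule nn_integral_density) simp_all

lemma rotation_invariant_fock: "rotation_invariant \<mu>"
  unfolding fock_measure_def
  by (rule rotation_invariant_radial_density) (auto simp: fock_density_def norm_mult)

text \<open>The integrand at \<open>z\<close> is dominated by the \<open>j\<close>-th term of a series of multiples of indicators of the
  discs of radius \<open>j + 1\<close>, where \<open>j\<close> is the integer part of \<open>|z|\<close>. The integrals of these terms are of
  order \<open>1 / (1 + j)\<^sup>2\<close>.\<close>

lemma integrable_moment: "integrable \<mu> (\<lambda>z. cmod z ^ k)"
proof (rule integrableI_bounded)
  obtain C where C: "C \<ge> 0" "\<And>x. x \<ge> 0 \<Longrightarrow> x ^ k * exp (- \<alpha> * x powr m) \<le> C / (1 + x) ^ 4"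
    using power_times_exp_decay[OF m_pos alpha_pos] by blast
  have [simp]: "0 \<le> \<rho> 0" using rho_pos[of 0] by simp
  define t where "t j = \<rho> 0 * (C / (1 + real j) ^ 4)" for j :: nat
  have t: "t j \<ge> 0" for j using C by (simp add: t_def)
  have "(\<integral>\<^sup>+z. ennreal (norm (cmod z ^ k)) \<partial>\<mu>) = (\<integral>\<^sup>+z. ennreal (\<rho> z) * ennreal (cmod z ^ k) \<partial>lborel)"
    by (subst nn_integral_fock) (simp_all add: norm_power)
  also have "\<dots> \<le> (\<integral>\<^sup>+z. (\<Sum>j. ennreal (t j) * indicator (cball (0::complex) (real j + 1)) z) \<partial>lborel)"
  proof (rule nn_integral_mono)
    fix z :: complex
    define j where "j = nat \<lfloor>cmod z\<rfloor>"
    have j: "real j \<le> cmod z" "cmod z \<le> real j + 1" by (simp_all add: j_def)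
    have "\<rho> z * cmod z ^ k = \<rho> 0 * (cmod z ^ k * exp (- \<alpha> * cmod z powr m))"
      by (subst rho_eq) simp
    also have "\<dots> \<le> \<rho> 0 * (C / (1 + cmod z) ^ 4)"
      by (intro mult_left_mono C) auto
    also have "\<dots> \<le> t j"
      unfolding t_def using j C by (intro mult_left_mono divide_left_mono power_mono) auto
    finally have "ennreal (\<rho> z) * ennreal (cmod z ^ k)
        \<le> ennreal (t j) * indicator (cball 0 (real j + 1)) z"
      using j t rho_pos[of z] by (simp add: ennreal_mult[symmetric] ennreal_leI)
    also have "\<dots> = (\<Sum>i\<in>{j}. ennreal (t i) * indicator (cball 0 (real i + 1)) z)"
      by (subst sum.insert) auto
    also have "\<dots> \<le> (\<Sum>i. ennreal (t i) * indicator (cball 0 (real i + 1)) z)"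
      by (intro sum_le_suminf) auto
    finally show "ennreal (\<rho> z) * ennreal (cmod z ^ k)
        \<le> (\<Sum>i. ennreal (t i) * indicator (cball 0 (real i + 1)) z)" .
  qed
  also have "\<dots> = (\<Sum>j. \<integral>\<^sup>+z. ennreal (t j) * indicator (cball (0::complex) (real j + 1)) z \<partial>lborel)"
    by (rule nn_integral_suminf) (auto intro!: borel_measurable_times_ennreal borel_measurable_indicator)
  also have "\<dots> = (\<Sum>j. ennreal (\<rho> 0 * C * pi * (1 / (1 + real j) ^ 2)))"
  proof (rule suminf_cong)
    fix j
    have "t j * (pi * (real j + 1)\<^sup>2) = \<rho> 0 * C * pi * (1 / (1 + real j) ^ 2)"
    proof -
      define x where "x = 1 + real j"
      have "x > 0" by (simp add: x_def)
      then have "\<rho> 0 * (C / x ^ 4) * (pi * x\<^sup>2) = \<rho> 0 * C * pi * (1 / x\<^sup>2)"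
        by (simp add: field_simps flip: power_add)
      then show ?thesis by (simp add: t_def x_def add.commute)
    qed
    then show "(\<integral>\<^sup>+z. ennreal (t j) * indicator (cball (0::complex) (real j + 1)) z \<partial>lborel)
        = ennreal (\<rho> 0 * C * pi * (1 / (1 + real j) ^ 2))"
      by (subst nn_integral_cmult_indicator)
        (auto simp: emeasure_cball unit_ball_vol_2 t ennreal_mult[symmetric])
  qed
  also have "\<dots> < \<infinity>"
  proof -
    have "summable (\<lambda>j. 1 / (1 + real j) ^ 2)"
      using inverse_power_summable[of 2, where 'a = real] summable_Suc_iff[of "\<lambda>j. inverse ((real j)\<^sup>2)"]
      by (simp add: inverse_eq_divide add.commute)
    then have "summable (\<lambda>j. \<rho> 0 * C * pi * (1 / (1 + real j) ^ 2))"
      by (rule summable_mult)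
    then show ?thesis
      using C by (subst suminf_ennreal2) auto
  qed
  finally show "(\<integral>\<^sup>+z. ennreal (norm (cmod z ^ k)) \<partial>\<mu>) < \<infinity>" .
qed simp

lemma finite_measure_fock: "finite_measure \<mu>"
proof
  have "(\<integral>\<^sup>+z. 1 \<partial>\<mu>) < \<infinity>"
    using integrable_moment[of 0] by (simp add: integrable_iff_bounded)
  then show "emeasure \<mu> (space \<mu>) \<noteq> \<infinity>" by simp
qed

lemma fock_space_holomorphic: "f \<in> H \<Longrightarrow> f holomorphic_on UNIV"
  by (simp add: fock_space_def)

lemma fock_space_continuous: "f \<in> H \<Longrightarrow> continuous_on A f"
  using fock_space_holomorphic holomorphic_on_imp_continuous_on continuous_on_subset by blast

lemma fock_space_integrable: "f \<in> H \<Longrightarrow> integrable \<mu> (\<lambda>z. (cmod (f z))\<^sup>2)"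
  by (simp add: fock_space_def)

lemma fock_spaceI:
  assumes "f holomorphic_on UNIV" "(\<integral>\<^sup>+z. ennreal ((cmod (f z))\<^sup>2) \<partial>\<mu>) < \<infinity>"
  shows "f \<in> H"
proof -
  have [measurable]: "f \<in> borel_measurable borel"
    using assms by (auto intro!: borel_measurable_continuous_onI holomorphic_on_imp_continuous_on)
  show ?thesis using assms by (auto simp: fock_space_def integrable_iff_bounded)
qed

lemma nn_integral_cmod_square: "f \<in> H \<Longrightarrow> (\<integral>\<^sup>+z. ennreal ((cmod (f z))\<^sup>2) \<partial>\<mu>) = ennreal ((nrm f)\<^sup>2)"
  by (simp add: fock_norm_square nn_integral_eq_integral fock_space_integrable)

lemma monomial_in_fock_space: "(\<lambda>z. z ^ n) \<in> H"
  using integrable_moment[of "n * 2"]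
  by (auto simp: fock_space_def norm_power power_mult intro!: holomorphic_intros)

lemma zero_in_fock_space: "(\<lambda>z. 0) \<in> H"
  by (simp add: fock_space_def)

lemma integrable_fock_inner:
  assumes "f \<in> H" "g \<in> H"
  shows "integrable \<mu> (\<lambda>z. f z * cnj (g z))"
proof (rule Bochner_Integration.integrable_bound)
  note [measurable] = fock_space_measurable[OF assms(1)] fock_space_measurable[OF assms(2)]
  show "integrable \<mu> (\<lambda>z. (cmod (f z))\<^sup>2 + (cmod (g z))\<^sup>2)"
    using assms by (intro Bochner_Integration.integrable_add fock_space_integrable)
  show "(\<lambda>z. f z * cnj (g z)) \<in> borel_measurable \<mu>" by measurable
  have "x * y \<le> x\<^sup>2 + y\<^sup>2" if "x \<ge> 0" "y \<ge> 0" for x y :: real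
    using sum_squares_bound[of x y] mult_nonneg_nonneg[OF that] by linarith
  then show "AE z in \<mu>. cmod (f z * cnj (g z)) \<le> norm ((cmod (f z))\<^sup>2 + (cmod (g z))\<^sup>2)"
    by (auto simp: norm_mult)
qed

text \<open>Pairing with a monomial reads off a Taylor coefficient: this holds on every disc centred at the
  origin, and dominated convergence lets the radius tend to infinity.\<close>

lemma fock_inner_monomial:
  assumes f: "f \<in> H"
  shows "ip f (\<lambda>z. z ^ n) = (deriv ^^ n) f 0 / fact n * complex_of_real ((nrm (\<lambda>z. z ^ n))\<^sup>2)"
proof -
  have truncate: "(\<lambda>i. LINT z|\<mu>. indicator (cball 0 (real i)) z * (g z * cnj (h z)))
      \<longlonglongrightarrow> ip g h" if g: "g \<in> H" and h: "h \<in> H" for g h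
    unfolding fock_inner_def
  proof (rule integral_dominated_convergence)
    note [measurable] = fock_space_measurable[OF g] fock_space_measurable[OF h]
    show "(\<lambda>z. g z * cnj (h z)) \<in> borel_measurable \<mu>" by measurable
    have [measurable]: "(indicator (cball 0 (real i)) :: complex \<Rightarrow> complex) \<in> borel_measurable borel" for i
      by (intro borel_measurable_indicator) simp
    show "(\<lambda>z. indicator (cball 0 (real i)) z * (g z * cnj (h z))) \<in> borel_measurable \<mu>" for i
      by measurable
    show "integrable \<mu> (\<lambda>z. cmod (g z * cnj (h z)))"
      by (intro integrable_norm integrable_fock_inner g h)
    show "AE z in \<mu>. cmod (indicator (cball 0 (real i)) z * (g z * cnj (h z))) \<le> cmod (g z * cnj (h z))" for i
      by (auto simp: indicator_def)
    show "AE z in \<mu>. (\<lambda>i. indicator (cball 0 (real i)) z * (g z * cnj (h z))) \<longlonglongrightarrow> g z * cnj (h z)"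
    proof (rule AE_I2, rule tendsto_eventually)
      fix z :: complex
      obtain N where "cmod z \<le> real N" using real_arch_simple by blast
      then show "\<forall>\<^sub>F i in sequentially. indicator (cball 0 (real i)) z * (g z * cnj (h z)) = g z * cnj (h z)"
        by (intro eventually_sequentiallyI[of N]) (auto simp: indicator_def)
    qed
  qed
  have "emeasure \<mu> A < \<infinity>" for A
    using finite_measure.emeasure_finite[OF finite_measure_fock] by (simp add: less_top)
  then have "(LINT z|\<mu>. indicator (cball 0 (real i)) z * (f z * cnj (z ^ n)))
      = (deriv ^^ n) f 0 / fact n * (LINT z|\<mu>. indicator (cball 0 (real i)) z * (z ^ n * cnj (z ^ n)))" for i
    by (intro disc_integral_against_monomial rotation_invariant_fock fock_space_holomorphic f) auto
  then have "ip f (\<lambda>z. z ^ n) = (deriv ^^ n) f 0 / fact n * ip (\<lambda>z. z ^ n) (\<lambda>z. z ^ n)"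
    using truncate[OF f monomial_in_fock_space[of n]]
      tendsto_mult_left[OF truncate[OF monomial_in_fock_space monomial_in_fock_space], of "(deriv ^^ n) f 0 / fact n" n n]
    by (intro LIMSEQ_unique) simp_all
  also have "ip (\<lambda>z. z ^ n) (\<lambda>z. z ^ n) = complex_of_real ((nrm (\<lambda>z. z ^ n))\<^sup>2)"
    unfolding fock_inner_def fock_norm_square complex_norm_square[symmetric]
    by (rule integral_complex_of_real)
  finally show ?thesis .
qed

text \<open>Applying the area mean value property to \<open>f\<^sup>2\<close>, instead of \<open>f\<close>, bounds \<open>|f w|\<^sup>2\<close> directly by the
  integral of \<open>|f|\<^sup>2\<close> over the unit disc around \<open>w\<close>. There the density is at least its value \<open>\<delta>\<close> at
  radius \<open>R + 1\<close>.\<close>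

lemma fock_point_evaluation:
  assumes "R \<ge> 0"
  obtains C where "C > 0" "\<And>f w. f \<in> H \<Longrightarrow> cmod w \<le> R \<Longrightarrow> cmod (f w) \<le> C * nrm f"
proof -
  define \<delta> where "\<delta> = \<rho> (of_real (R + 1))"
  have \<delta>: "\<delta> > 0" by (simp add: \<delta>_def rho_pos)
  have main: "pi * (cmod (f w))\<^sup>2 \<le> (nrm f)\<^sup>2 / \<delta>" if f: "f \<in> H" and w: "cmod w \<le> R" for f w
  proof -
    note [measurable] = fock_space_measurable[OF f]
    have [measurable]: "(indicator (cball 0 1) :: complex \<Rightarrow> ennreal) \<in> borel_measurable borel"
      by (intro borel_measurable_indicator) simp
    have "integrable lborel (\<lambda>z. indicator (cball 0 1) z *\<^sub>R (f (w + z))\<^sup>2)"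
    proof (rule borel_integrable_compact)
      show "continuous_on (cball 0 1) (\<lambda>z. (f (w + z))\<^sup>2)"
        by (intro continuous_intros continuous_on_compose2[OF fock_space_continuous[OF f, of UNIV]]) auto
    qed simp
    also have "(\<lambda>z. indicator (cball 0 1) z *\<^sub>R (f (w + z))\<^sup>2) = (\<lambda>z. indicator (cball 0 1) z * (f (w + z))\<^sup>2)"
      by (auto simp: indicator_def)
    finally have int: "integrable lborel (\<lambda>z. indicator (cball 0 1) z * (f (w + z))\<^sup>2)" .
    have "ennreal (pi * (cmod (f w))\<^sup>2) = ennreal (cmod (of_real pi * (f w)\<^sup>2))"
      by (simp add: norm_mult norm_power)
    also have "of_real pi * (f w)\<^sup>2 = (LINT z|lborel. indicator (cball 0 1) z * (f (w + z))\<^sup>2)"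
      by (rule area_mean_value) (intro holomorphic_intros fock_space_holomorphic f)
    also have "ennreal (cmod \<dots>) \<le> (\<integral>\<^sup>+z. ennreal (cmod (indicator (cball 0 1) z * (f (w + z))\<^sup>2)) \<partial>lborel)"
      by (rule integral_norm_bound_ennreal[OF int])
    also have "\<dots> = (\<integral>\<^sup>+z. indicator (cball 0 1) (w + z - w) * ennreal ((cmod (f (w + z)))\<^sup>2) \<partial>lborel)"
      by (intro nn_integral_cong) (auto simp: indicator_def norm_power)
    also have "\<dots> = (\<integral>\<^sup>+z. indicator (cball 0 1) (z - w) * ennreal ((cmod (f z))\<^sup>2) \<partial>lborel)"
      by (rule nn_integral_lborel_translate[where g = "\<lambda>z. indicator (cball 0 1) (z - w) * ennreal ((cmod (f z))\<^sup>2)"]) measurable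
    also have "\<dots> \<le> (\<integral>\<^sup>+z. ennreal (1 / \<delta>) * (ennreal (\<rho> z) * ennreal ((cmod (f z))\<^sup>2)) \<partial>lborel)"
    proof (rule nn_integral_mono)
      fix z
      show "indicator (cball 0 1) (z - w) * ennreal ((cmod (f z))\<^sup>2)
          \<le> ennreal (1 / \<delta>) * (ennreal (\<rho> z) * ennreal ((cmod (f z))\<^sup>2))"
      proof (cases "z - w \<in> cball 0 1")
        case True
        then have "cmod z \<le> cmod (complex_of_real (R + 1))"
          using w norm_triangle_sub[of z w] assms by (simp add: norm_of_real del: of_real_add)
        then have "\<delta> \<le> \<rho> z" unfolding \<delta>_def by (rule rho_antimono)
        then have "1 * (cmod (f z))\<^sup>2 \<le> (1 / \<delta> * \<rho> z) * (cmod (f z))\<^sup>2"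
          using \<delta> by (intro mult_right_mono) (auto simp: field_simps)
        then show ?thesis
          using True \<delta> rho_pos[of z] by (simp add: ennreal_mult[symmetric] ennreal_leI mult.assoc)
      qed simp
    qed
    also have "\<dots> = ennreal (1 / \<delta>) * ennreal ((nrm f)\<^sup>2)"
      by (subst nn_integral_cmult) (simp_all add: nn_integral_fock[symmetric] nn_integral_cmod_square f)
    also have "\<dots> = ennreal ((nrm f)\<^sup>2 / \<delta>)"
      using \<delta> by (simp add: ennreal_mult[symmetric])
    finally show ?thesis using \<delta> by (subst (asm) ennreal_le_iff) auto
  qed
  define C where "C = sqrt (1 / (pi * \<delta>))"
  have "cmod (f w) \<le> C * nrm f" if "f \<in> H" "cmod w \<le> R" for f w
  proof (rule power2_le_imp_le)
    have "(C * nrm f)\<^sup>2 = (nrm f)\<^sup>2 / \<delta> / pi"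
      using \<delta> by (simp add: C_def power_mult_distrib)
    moreover have "(cmod (f w))\<^sup>2 \<le> (nrm f)\<^sup>2 / \<delta> / pi"
      using main[OF that] by (subst pos_le_divide_eq) (simp_all add: mult.commute)
    ultimately show "(cmod (f w))\<^sup>2 \<le> (C * nrm f)\<^sup>2" by simp
  qed (use \<delta> in \<open>simp add: C_def fock_norm_nonneg\<close>)
  moreover have "C > 0" using \<delta> by (simp add: C_def)
  ultimately show thesis using that by blast
qed


section \<open>Inner product geometry\<close>

lemma fock_inner_commute: "ip g f = cnj (ip f g)"
  using Bochner_Integration.integral_cnj[of \<mu> "\<lambda>z. f z * cnj (g z)"]
  by (simp only: fock_inner_def complex_cnj_mult complex_cnj_cnj mult.commute)

lemma fock_inner_self: "ip f f = complex_of_real ((nrm f)\<^sup>2)"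
  unfolding fock_inner_def fock_norm_square complex_norm_square[symmetric]
  by (rule integral_complex_of_real)

lemma fock_inner_add: "f \<in> H \<Longrightarrow> g \<in> H \<Longrightarrow> h \<in> H \<Longrightarrow> ip (\<lambda>z. f z + g z) h = ip f h + ip g h"
  unfolding fock_inner_def
  by (subst Bochner_Integration.integral_add[symmetric]) (simp_all add: integrable_fock_inner distrib_right)

lemma fock_inner_cmult: "ip (\<lambda>z. a * f z) h = a * ip f h"
  unfolding fock_inner_def by (simp add: mult.assoc)

lemma fock_inner_diff_cmult:
  "f \<in> H \<Longrightarrow> g \<in> H \<Longrightarrow> h \<in> H \<Longrightarrow> ip (\<lambda>z. f z - a * g z) h = ip f h - a * ip g h"
  using fock_inner_add[of f "\<lambda>z. (- a) * g z" h] fock_inner_cmult[of "- a" g h]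
    fock_space_cmult[of g \<alpha> m "- a"] by simp

lemma fock_norm_cmult: "nrm (\<lambda>z. a * f z) = cmod a * nrm f"
  by (simp add: fock_norm_eq norm_mult power_mult_distrib real_sqrt_mult)

lemma fock_norm_minus_commute: "nrm (\<lambda>z. f z - g z) = nrm (\<lambda>z. g z - f z)"
  by (simp add: fock_norm_eq norm_minus_commute)

lemma fock_space_sum:
  assumes "\<And>k. k \<in> A \<Longrightarrow> u k \<in> H"
  shows "(\<lambda>z. \<Sum>k\<in>A. a k * u k z) \<in> H"
  using assms
proof (induction A rule: infinite_finite_induct)
  case (insert k A)
  then show ?case
    using fock_space_add[OF fock_space_cmult[of "u k" \<alpha> m "a k"], of "\<lambda>z. \<Sum>k\<in>A. a k * u k z"] by simp
qed (simp_all add: zero_in_fock_space)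

lemma fock_inner_sum:
  assumes "\<And>k. k \<in> A \<Longrightarrow> u k \<in> H" "h \<in> H"
  shows "ip (\<lambda>z. \<Sum>k\<in>A. a k * u k z) h = (\<Sum>k\<in>A. a k * ip (u k) h)"
  using assms
proof (induction A rule: infinite_finite_induct)
  case (insert k A)
  then show ?case
    using fock_inner_add[OF fock_space_cmult[of "u k" \<alpha> m "a k"] fock_space_sum[of A u a], of h]
    by (simp add: fock_inner_cmult)
qed (simp_all add: fock_inner_def)

text \<open>Pythagoras for the projection onto one vector \<open>u\<close>. The case \<open>u = 0\<close> is included so that sequences
  padded by zeros can be treated together with orthonormal ones.\<close>

lemma fock_norm_projection_remainder:
  assumes f: "f \<in> H" and u: "u \<in> H" and unit: "ip u u = 1 \<or> ip u u = 0"
  shows "(nrm (\<lambda>z. f z - ip f u * u z))\<^sup>2 = (nrm f)\<^sup>2 - (cmod (ip f u))\<^sup>2"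
proof -
  define a where "a = ip f u"
  define r where "r z = f z - a * u z" for z
  have r: "r \<in> H" unfolding r_def using fock_space_diff[OF f fock_space_cmult[OF u]] .
  \<comment> \<open>If \<open>u\<close> is not a unit vector it vanishes, and then so does \<open>a\<close>.\<close>
  have unit': "a * ip u u = a"
  proof (cases "ip u u = 1")
    case False
    then have "nrm u = 0" using unit by (auto simp: fock_inner_self)
    then have "u = (\<lambda>z. 0)" using fock_norm_zero_iff[OF m_pos alpha_pos u] by simp
    then show ?thesis by (simp add: a_def fock_inner_def)
  qed simp
  have "ip r u = 0"
    unfolding r_def using fock_inner_diff_cmult[OF f u u, of a] unit' by (simp add: a_def)
  then have "ip u r = 0" by (subst fock_inner_commute) simp
  then have "ip r r = ip f r"
    using fock_inner_diff_cmult[OF f u r, of a] by (simp add: r_def[abs_def])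
  also have "\<dots> = cnj (ip r f)" by (rule fock_inner_commute)
  also have "ip r f = ip f f - a * ip u f"
    unfolding r_def by (rule fock_inner_diff_cmult[OF f u f])
  also have "ip u f = cnj a" unfolding a_def by (rule fock_inner_commute)
  finally have "complex_of_real ((nrm r)\<^sup>2) = complex_of_real ((nrm f)\<^sup>2 - (cmod a)\<^sup>2)"
    by (simp only: fock_inner_self complex_norm_square[symmetric] of_real_diff[symmetric] complex_cnj_complex_of_real)
  then have "(nrm r)\<^sup>2 = (nrm f)\<^sup>2 - (cmod a)\<^sup>2"
    by (simp only: of_real_eq_iff)
  then show ?thesis by (simp add: r_def[abs_def] a_def)
qed

lemma fock_inner_le_norm:
  assumes "f \<in> H" "u \<in> H" "ip u u = 1 \<or> ip u u = 0"
  shows "cmod (ip f u) \<le> nrm f"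
proof (rule power2_le_imp_le)
  show "(cmod (ip f u))\<^sup>2 \<le> (nrm f)\<^sup>2"
    using fock_norm_projection_remainder[OF assms] zero_le_power2[of "nrm (\<lambda>z. f z - ip f u * u z)"]
    by linarith
qed (rule fock_norm_nonneg)

text \<open>Zero vectors are admitted in order to index every countable orthonormal set, finite or infinite, by
  all of \<open>nat\<close>.\<close>

definition orthonormal_or_zero :: "(nat \<Rightarrow> complex \<Rightarrow> complex) \<Rightarrow> bool" where
  "orthonormal_or_zero u \<longleftrightarrow>
     (\<forall>k. u k \<in> H \<and> (ip (u k) (u k) = 1 \<or> ip (u k) (u k) = 0)) \<and>
     (\<forall>j k. j \<noteq> k \<longrightarrow> ip (u j) (u k) = 0)"

lemma fock_inner_remainder:
  assumes u: "orthonormal_or_zero u" and g: "g \<in> H" and "finite A"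
  shows "ip (\<lambda>z. g z - (\<Sum>k\<in>A. ip g (u k) * u k z)) (u j) = (if j \<in> A then 0 else ip g (u j))"
proof -
  have uH: "u k \<in> H" for k using u by (simp add: orthonormal_or_zero_def)
  have self: "ip g (u j) * ip (u j) (u j) = ip g (u j)"
  proof (cases "ip (u j) (u j) = 1")
    case False
    then have "ip (u j) (u j) = 0" using u by (auto simp: orthonormal_or_zero_def)
    then have "nrm (u j) = 0" by (simp add: fock_inner_self)
    then have "u j = (\<lambda>z. 0)" using fock_norm_zero_iff[OF m_pos alpha_pos uH] by simp
    then show ?thesis by (simp add: fock_inner_def)
  qed simp
  have "ip (\<lambda>z. g z - (\<Sum>k\<in>A. ip g (u k) * u k z)) (u j)
      = ip g (u j) - (\<Sum>k\<in>A. ip g (u k) * ip (u k) (u j))"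
    using fock_inner_diff_cmult[OF g fock_space_sum[of A u "\<lambda>k. ip g (u k)"] uH[of j], of 1] uH
    by (simp add: fock_inner_sum)
  also have "(\<Sum>k\<in>A. ip g (u k) * ip (u k) (u j)) = (\<Sum>k\<in>A. if k = j then ip g (u j) else 0)"
    using u self by (intro sum.cong) (auto simp: orthonormal_or_zero_def)
  finally show ?thesis using \<open>finite A\<close> by (simp add: sum.delta')
qed

lemma fock_norm_remainder:
  assumes u: "orthonormal_or_zero u" and g: "g \<in> H" and "finite A"
  shows "(nrm (\<lambda>z. g z - (\<Sum>k\<in>A. ip g (u k) * u k z)))\<^sup>2 = (nrm g)\<^sup>2 - (\<Sum>k\<in>A. (cmod (ip g (u k)))\<^sup>2)"
  using \<open>finite A\<close>
proof (induction A)
  case (insert k A)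
  define r where "r z = g z - (\<Sum>k\<in>A. ip g (u k) * u k z)" for z
  have uH: "u k \<in> H" for k using u by (simp add: orthonormal_or_zero_def)
  have r: "r \<in> H" unfolding r_def by (intro fock_space_diff fock_space_sum g uH)
  have "ip r (u k) = ip g (u k)"
    unfolding r_def using fock_inner_remainder[OF u g] insert by simp
  moreover have "(nrm (\<lambda>z. r z - ip r (u k) * u k z))\<^sup>2 = (nrm r)\<^sup>2 - (cmod (ip r (u k)))\<^sup>2"
    using u by (intro fock_norm_projection_remainder r) (auto simp: orthonormal_or_zero_def)
  moreover have "(\<lambda>z. g z - (\<Sum>k\<in>insert k A. ip g (u k) * u k z)) = (\<lambda>z. r z - ip g (u k) * u k z)"
    using insert by (auto simp: r_def)
  ultimately show ?case using insert by (simp add: r_def[abs_def])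
qed simp

lemma fock_bessel:
  assumes "orthonormal_or_zero u" "g \<in> H" "finite A"
  shows "(\<Sum>k\<in>A. (cmod (ip g (u k)))\<^sup>2) \<le> (nrm g)\<^sup>2"
  using fock_norm_remainder[OF assms] zero_le_power2[of "nrm (\<lambda>z. g z - (\<Sum>k\<in>A. ip g (u k) * u k z))"]
  by linarith

text \<open>The projection \<open>s\<close> of \<open>g\<close> has the same coefficients as \<open>g\<close> and no remainder of its own.\<close>

lemma fock_norm_projection:
  assumes u: "orthonormal_or_zero u" and g: "g \<in> H" and "finite A"
  shows "(nrm (\<lambda>z. \<Sum>k\<in>A. ip g (u k) * u k z))\<^sup>2 = (\<Sum>k\<in>A. (cmod (ip g (u k)))\<^sup>2)"
proof -
  define r where "r z = g z - (\<Sum>k\<in>A. ip g (u k) * u k z)" for z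
  define s where "s z = (\<Sum>k\<in>A. ip g (u k) * u k z)" for z
  have uH: "u k \<in> H" for k using u by (simp add: orthonormal_or_zero_def)
  have s: "s \<in> H" unfolding s_def by (intro fock_space_sum uH)
  have "ip s (u k) = ip g (u k)" if "k \<in> A" for k
  proof -
    have "ip (\<lambda>z. g z - 1 * s z) (u k) = 0"
      unfolding s_def using fock_inner_remainder[OF u g \<open>finite A\<close>, of k] that by simp
    then show ?thesis using fock_inner_diff_cmult[OF g s uH, of 1 k] by simp
  qed
  then have "(\<lambda>z. s z - (\<Sum>k\<in>A. ip s (u k) * u k z)) = (\<lambda>z. 0)"
    "(\<Sum>k\<in>A. (cmod (ip s (u k)))\<^sup>2) = (\<Sum>k\<in>A. (cmod (ip g (u k)))\<^sup>2)"
    by (auto simp: s_def)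
  then have "(nrm s)\<^sup>2 = (\<Sum>k\<in>A. (cmod (ip g (u k)))\<^sup>2)"
    using fock_norm_remainder[OF u s \<open>finite A\<close>] by (simp add: fock_norm_square)
  then show ?thesis by (simp add: s_def[abs_def])
qed

section \<open>Completeness and orthonormal expansions\<close>

lemma fock_fatou:
  assumes f: "\<And>n. f n \<in> H" and B: "\<forall>\<^sub>F n in sequentially. nrm (f n) \<le> B"
    and h: "h holomorphic_on UNIV" and lim: "\<And>z. (\<lambda>n. f n z) \<longlonglongrightarrow> h z"
  shows "h \<in> H" and "nrm h \<le> B"
proof -
  note [measurable] = fock_space_measurable[OF f]
  obtain n where "nrm (f n) \<le> B" using eventually_happens'[OF _ B] by auto
  then have B0: "B \<ge> 0" using fock_norm_nonneg[of \<alpha> m "f n"] by linarith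
  have "(\<integral>\<^sup>+z. ennreal ((cmod (h z))\<^sup>2) \<partial>\<mu>) = (\<integral>\<^sup>+z. liminf (\<lambda>n. ennreal ((cmod (f n z))\<^sup>2)) \<partial>\<mu>)"
    by (intro nn_integral_cong lim_imp_Liminf[symmetric] tendsto_ennrealI tendsto_power tendsto_norm lim) simp
  also have "\<dots> \<le> liminf (\<lambda>n. \<integral>\<^sup>+z. ennreal ((cmod (f n z))\<^sup>2) \<partial>\<mu>)"
    by (rule nn_integral_liminf) measurable
  also have "\<dots> \<le> ennreal (B\<^sup>2)"
  proof (rule Liminf_le)
    show "\<forall>\<^sub>F n in sequentially. (\<integral>\<^sup>+z. ennreal ((cmod (f n z))\<^sup>2) \<partial>\<mu>) \<le> ennreal (B\<^sup>2)"
      using B by eventually_elim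
        (simp add: nn_integral_cmod_square[OF f] ennreal_leI power_mono fock_norm_nonneg)
  qed simp
  finally have le: "(\<integral>\<^sup>+z. ennreal ((cmod (h z))\<^sup>2) \<partial>\<mu>) \<le> ennreal (B\<^sup>2)" .
  show hH: "h \<in> H" by (rule fock_spaceI[OF h order.strict_trans1[OF le]]) simp
  show "nrm h \<le> B"
  proof (rule power2_le_imp_le)
    show "(nrm h)\<^sup>2 \<le> B\<^sup>2" using le by (simp add: nn_integral_cmod_square[OF hH])
  qed (rule B0)
qed

text \<open>Norm bounded sets are locally uniformly bounded by the estimate of point evaluations, hence normal;
  the limit stays in the ball by Fatou's lemma.\<close>

lemma fock_montel:
  assumes f: "\<And>n. f n \<in> H" and B: "\<And>n. nrm (f n) \<le> B"
  obtains h r where "h \<in> H" "nrm h \<le> B" "strict_mono (r :: nat \<Rightarrow> nat)"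
    "\<And>z. (\<lambda>n. f (r n) z) \<longlonglongrightarrow> h z"
    "\<And>K. compact K \<Longrightarrow> uniform_limit K (f \<circ> r) h sequentially"
proof -
  have bdd: "\<exists>C. \<forall>g\<in>range f. \<forall>z\<in>K. cmod (g z) \<le> C" if "compact K" for K
  proof -
    obtain R where R: "R > 0" "\<And>z. z \<in> K \<Longrightarrow> cmod z \<le> R"
      using compact_imp_bounded[OF \<open>compact K\<close>] unfolding bounded_pos by blast
    obtain C where C: "C > 0" "\<And>g w. g \<in> H \<Longrightarrow> cmod w \<le> R \<Longrightarrow> cmod (g w) \<le> C * nrm g"
      by (rule fock_point_evaluation[OF less_imp_le[OF R(1)]]) blast
    have "cmod (f n z) \<le> C * B" if "z \<in> K" for n z
      using C(2)[OF f R(2)[OF that], of n] mult_left_mono[OF B[of n], of C] C(1) by linarith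
    then show ?thesis by blast
  qed
  obtain h r where hr: "h holomorphic_on UNIV" "strict_mono (r :: nat \<Rightarrow> nat)"
    "\<And>z. z \<in> UNIV \<Longrightarrow> (\<lambda>n. f (r n) z) \<longlonglongrightarrow> h z"
    "\<And>K. compact K \<Longrightarrow> K \<subseteq> UNIV \<Longrightarrow> uniform_limit K (f \<circ> r) h sequentially"
    using Montel[of UNIV "range f" f] bdd f fock_space_holomorphic by blast
  have "h \<in> H" "nrm h \<le> B"
    using fock_fatou[of "\<lambda>n. f (r n)" B h] f B hr by auto
  with hr show thesis by (intro that[of h r]) auto
qed

text \<open>A locally uniform limit \<open>h\<close> of a subsequence exists by normality. Fatou's lemma applied to
  \<open>f i - f (N + r n)\<close>, with \<open>i\<close> fixed and \<open>n\<close> tending to infinity, carries the Cauchy estimate over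
  to \<open>f i - h\<close>.\<close>

lemma fock_complete:
  assumes f: "\<And>n. f n \<in> H"
    and cauchy: "\<And>e. e > 0 \<Longrightarrow> \<exists>N. \<forall>i\<ge>N. \<forall>j\<ge>N. nrm (\<lambda>z. f i z - f j z) \<le> e"
  obtains h where "h \<in> H" "(\<lambda>n. nrm (\<lambda>z. f n z - h z)) \<longlonglongrightarrow> 0"
proof -
  obtain N where N: "\<And>i j. i \<ge> N \<Longrightarrow> j \<ge> N \<Longrightarrow> nrm (\<lambda>z. f i z - f j z) \<le> 1"
    using cauchy[of 1] by auto
  have "nrm (f (N + n)) \<le> nrm (f N) + 1" for n
    using fock_norm_triangle[OF m_pos alpha_pos f fock_space_diff[OF f f], of N "N + n" N] N[of "N + n" N]
    by simp
  then obtain h r where hr: "h \<in> H" "strict_mono (r :: nat \<Rightarrow> nat)" "\<And>z. (\<lambda>n. f (N + r n) z) \<longlonglongrightarrow> h z"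
    by (rule fock_montel[of "\<lambda>n. f (N + n)", OF f]) blast+
  have "(\<lambda>n. nrm (\<lambda>z. f n z - h z)) \<longlonglongrightarrow> 0"
  proof (rule LIMSEQ_I)
    fix e :: real assume "e > 0"
    then obtain N' where N': "\<And>i j. i \<ge> N' \<Longrightarrow> j \<ge> N' \<Longrightarrow> nrm (\<lambda>z. f i z - f j z) \<le> e / 2"
      using cauchy[of "e / 2"] by auto
    have "nrm (\<lambda>z. f i z - h z) \<le> e / 2" if "i \<ge> N'" for i
    proof (rule fock_fatou(2)[of "\<lambda>n z. f i z - f (N + r n) z"])
      show "\<forall>\<^sub>F n in sequentially. nrm (\<lambda>z. f i z - f (N + r n) z) \<le> e / 2"
        using seq_suble[OF hr(2)] that
        by (intro eventually_sequentiallyI[of N'] N') (auto intro: trans_le_add2 order.trans)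
    qed (auto intro!: fock_space_diff f holomorphic_intros fock_space_holomorphic hr tendsto_intros)
    then show "\<exists>n0. \<forall>n\<ge>n0. norm (nrm (\<lambda>z. f n z - h z) - 0) < e"
      using \<open>e > 0\<close> fock_norm_nonneg by (intro exI[of _ N']) fastforce
  qed
  with hr(1) show thesis by (rule that)
qed

text \<open>The remainders \<open>r K\<close> of the partial sums are Cauchy by Bessel's inequality. Their limit is
  orthogonal to every \<open>u k\<close>, so it is zero by maximality, and convergence in norm implies pointwise
  convergence.\<close>

lemma fock_expansion:
  assumes u: "orthonormal_or_zero u" and g: "g \<in> H"
    and maximal: "\<And>f. f \<in> H \<Longrightarrow> (\<And>k. ip f (u k) = 0) \<Longrightarrow> f = (\<lambda>z. 0)"
  shows "(\<lambda>k. ip g (u k) * u k w) sums g w"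
proof -
  have uH: "u k \<in> H" for k using u by (simp add: orthonormal_or_zero_def)
  define r where "r K z = g z - (\<Sum>k<K. ip g (u k) * u k z)" for K z
  have r: "r K \<in> H" for K unfolding r_def by (intro fock_space_diff fock_space_sum g uH)
  define b where "b k = (cmod (ip g (u k)))\<^sup>2" for k
  have "summable b"
  proof (rule summableI_nonneg_bounded)
    show "(\<Sum>k<n. b k) \<le> (nrm g)\<^sup>2" for n
      unfolding b_def by (rule fock_bessel[OF u g]) simp
  qed (simp add: b_def)
  have diff: "(nrm (\<lambda>z. r i z - r j z))\<^sup>2 = (\<Sum>k\<in>{i..<j}. b k)" if "i \<le> j" for i j
  proof -
    have "r i z - r j z = (\<Sum>k\<in>{i..<j}. ip g (u k) * u k z)" for z
      using sum_diff_nat_ivl[of 0 i j "\<lambda>k. ip g (u k) * u k z"] that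
      by (simp add: r_def atLeast0LessThan)
    then show ?thesis
      using fock_norm_projection[OF u g, of "{i..<j}"] by (simp add: b_def)
  qed
  have "\<exists>N. \<forall>i\<ge>N. \<forall>j\<ge>N. nrm (\<lambda>z. r i z - r j z) \<le> e" if "e > 0" for e
  proof -
    obtain N where N: "\<And>i j. i \<ge> N \<Longrightarrow> norm (\<Sum>k\<in>{i..<j}. b k) < e\<^sup>2"
      using \<open>summable b\<close> zero_less_power[OF \<open>e > 0\<close>, of 2] unfolding summable_Cauchy by blast
    have le: "nrm (\<lambda>z. r i z - r j z) \<le> e" if "i \<ge> N" "i \<le> j" for i j
    proof (rule power2_le_imp_le)
      show "(nrm (\<lambda>z. r i z - r j z))\<^sup>2 \<le> e\<^sup>2"
        using N[OF that(1), of j] diff[OF that(2)] by simp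
    qed (use \<open>e > 0\<close> in simp)
    have "nrm (\<lambda>z. r i z - r j z) \<le> e" if "i \<ge> N" "j \<ge> N" for i j
      using le[of i j] le[of j i] that fock_norm_minus_commute[of "r i" "r j"] by (cases "i \<le> j") auto
    then show ?thesis by blast
  qed
  with r obtain h where h: "h \<in> H" "(\<lambda>n. nrm (\<lambda>z. r n z - h z)) \<longlonglongrightarrow> 0"
    using fock_complete[of r] by blast
  have "ip h (u k) = 0" for k
  proof -
    have "cmod (ip h (u k)) \<le> nrm (\<lambda>z. r n z - h z)" if "n > k" for n
    proof -
      have "ip (r n) (u k) = 0"
        unfolding r_def using fock_inner_remainder[OF u g, of "{..<n}" k] that by simp
      then have "ip (\<lambda>z. r n z - h z) (u k) = - ip h (u k)"
        using fock_inner_diff_cmult[OF r[of n] h(1) uH[of k], of 1] by simp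
      then have "cmod (ip h (u k)) = cmod (ip (\<lambda>z. r n z - h z) (u k))" by simp
      also have "\<dots> \<le> nrm (\<lambda>z. r n z - h z)"
        using u by (intro fock_inner_le_norm fock_space_diff r h) (auto simp: orthonormal_or_zero_def)
      finally show ?thesis .
    qed
    then have "cmod (ip h (u k)) \<le> 0"
      by (intro LIMSEQ_le_const[OF h(2)]) (auto intro!: exI[of _ "Suc k"])
    then show ?thesis by simp
  qed
  then have h0: "h = (\<lambda>z. 0)" by (rule maximal[OF h(1)])
  obtain C where C: "C > 0" "\<And>f z. f \<in> H \<Longrightarrow> cmod z \<le> cmod w \<Longrightarrow> cmod (f z) \<le> C * nrm f"
    by (rule fock_point_evaluation[OF norm_ge_zero[of w]]) blast
  have "(\<lambda>n. r n w) \<longlonglongrightarrow> 0"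
  proof (rule Lim_null_comparison)
    show "\<forall>\<^sub>F n in sequentially. cmod (r n w) \<le> C * nrm (r n)"
      by (intro always_eventually allI C r) simp
    show "(\<lambda>n. C * nrm (r n)) \<longlonglongrightarrow> 0"
      using tendsto_mult_right_zero[OF h(2), of C] by (simp add: h0)
  qed
  then have "(\<lambda>n. g w - r n w) \<longlonglongrightarrow> g w"
    using tendsto_diff[OF tendsto_const[of "g w"]] by fastforce
  then show ?thesis by (simp add: r_def sums_def)
qed

end

section \<open>Composition with an affine contraction\<close>

text \<open>Here \<open>q\<close> is the midpoint of \<open>|c|\<close> and 1, and \<open>R\<close> is the radius with \<open>|b| + |c| R = q R\<close>.\<close>

lemma affine_contraction_bound:
  fixes b c :: complex
  assumes "cmod c < 1"
  obtains q R where "0 < q" "q < 1" "R \<ge> 0" "\<And>z. cmod (b + c * z) \<le> q * max (cmod z) R"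
proof -
  define q where "q = (1 + cmod c) / 2"
  define R where "R = cmod b / (q - cmod c)"
  have q: "0 < q" "q < 1" "cmod c < q" using assms by (auto simp: q_def add_pos_nonneg)
  have "cmod (b + c * z) \<le> q * max (cmod z) R" for z
  proof -
    have "cmod (b + c * z) \<le> (q - cmod c) * R + cmod c * cmod z"
      using norm_triangle_ineq[of b "c * z"] q by (simp add: R_def norm_mult)
    also have "\<dots> \<le> (q - cmod c) * max (cmod z) R + cmod c * max (cmod z) R"
      using q by (intro add_mono mult_left_mono) auto
    finally show ?thesis by (simp add: algebra_simps)
  qed
  moreover have "R \<ge> 0" using q by (simp add: R_def)
  ultimately show thesis using q that by blast
qed

context fock_parameters
begin

lemma nn_integral_fock_const: "(\<integral>\<^sup>+z. ennreal x \<partial>\<mu>) = ennreal x * ennreal (measure \<mu> UNIV)"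
proof -
  have "space \<mu> = UNIV" by (simp add: fock_measure_def)
  then show ?thesis
    using finite_measure.emeasure_eq_measure[OF finite_measure_fock, of UNIV] by simp
qed

text \<open>For large \<open>|z|\<close> the density at \<open>b + c z\<close> is at least that at radius \<open>q |z|\<close>, and the ratio of the
  densities at radii \<open>x\<close> and \<open>q x\<close> is \<open>exp (- \<alpha> (1 - q\<^sup>m) x\<^sup>m)\<close>.\<close>

lemma density_ratio:
  assumes c: "cmod c < 1" and e: "e > 0"
  obtains R where "R \<ge> 0" "\<And>z. cmod z \<ge> R \<Longrightarrow> \<rho> z \<le> e * \<rho> (b + c * z)"
proof -
  obtain q R0 where q: "0 < q" "q < 1" "R0 \<ge> 0" and le: "\<And>z. cmod (b + c * z) \<le> q * max (cmod z) R0"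
    using affine_contraction_bound[OF c] by blast
  have "q powr m < 1" using q m_pos powr_less_mono2[of m q 1] by simp
  then have "\<alpha> * (1 - q powr m) > 0" using alpha_pos by simp
  moreover have "((\<lambda>x. exp (- d * x powr m)) \<longlongrightarrow> 0) at_top" if "d > 0" for d
    using that m_pos by real_asymp
  ultimately have "((\<lambda>x. exp (- (\<alpha> * (1 - q powr m)) * x powr m)) \<longlongrightarrow> 0) at_top"
    by blast
  then have "\<forall>\<^sub>F x in at_top. exp (- (\<alpha> * (1 - q powr m)) * x powr m) < e"
    by (rule order_tendstoD) (rule e)
  then obtain X where X: "\<And>x. x \<ge> X \<Longrightarrow> exp (- (\<alpha> * (1 - q powr m)) * x powr m) < e"
    by (auto simp: eventually_at_top_linorder)
  have "\<rho> z \<le> e * \<rho> (b + c * z)" if z: "cmod z \<ge> max R0 X" for z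
  proof -
    have "\<rho> z = exp (- (\<alpha> * (1 - q powr m)) * cmod z powr m) * (\<rho> 0 * exp (- \<alpha> * (q * cmod z) powr m))"
      using q by (subst rho_eq) (simp add: powr_mult exp_add[symmetric] algebra_simps)
    also have "\<rho> 0 * exp (- \<alpha> * (q * cmod z) powr m) = \<rho> (of_real (q * cmod z))"
      using q by (subst (2) rho_eq) (simp add: norm_mult)
    also have "exp (- (\<alpha> * (1 - q powr m)) * cmod z powr m) * \<rho> (of_real (q * cmod z)) \<le> e * \<rho> (b + c * z)"
    proof (rule mult_mono)
      show "exp (- (\<alpha> * (1 - q powr m)) * cmod z powr m) \<le> e"
        using X[of "cmod z"] z by simp
      show "\<rho> (of_real (q * cmod z)) \<le> \<rho> (b + c * z)"
        using le[of z] z q by (intro rho_antimono) (simp add: norm_mult max_absorb1)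
    qed (use e rho_pos in \<open>auto simp: less_imp_le\<close>)
    finally show ?thesis .
  qed
  then show thesis using q(3) by (intro that[of "max R0 X"]) auto
qed

text \<open>Inside the disc of radius \<open>R\<close> the integrand is bounded by \<open>B\<^sup>2\<close>. Outside, \<open>\<rho> z\<close> is replaced by a small
  multiple of \<open>\<rho> (b + c z)\<close>, and the substitution \<open>w = b + c z\<close> turns the integral into the norm of \<open>h\<close>,
  at the cost of the Jacobian factor \<open>1 / |c|\<^sup>2\<close>. For \<open>c = 0\<close> the function \<open>h \<circ> \<phi>\<close> is constant.\<close>

lemma composition_norm_estimate:
  assumes c: "cmod c < 1" and e: "e > 0"
  obtains R where "R \<ge> 0"
    "\<And>h B. h \<in> H \<Longrightarrow> (\<And>z. cmod z \<le> R \<Longrightarrow> cmod (h (b + c * z)) \<le> B) \<Longrightarrow>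
      (\<integral>\<^sup>+z. ennreal ((cmod (h (b + c * z)))\<^sup>2) \<partial>\<mu>) \<le> ennreal (B\<^sup>2 * measure \<mu> UNIV + e * (nrm h)\<^sup>2)"
proof (cases "c = 0")
  case True
  have "(\<integral>\<^sup>+z. ennreal ((cmod (h (b + c * z)))\<^sup>2) \<partial>\<mu>) \<le> ennreal (B\<^sup>2 * measure \<mu> UNIV + e * (nrm h)\<^sup>2)"
    if "\<And>z. cmod z \<le> 0 \<Longrightarrow> cmod (h (b + c * z)) \<le> B" for h B
  proof -
    have "(cmod (h b))\<^sup>2 \<le> B\<^sup>2" using that[of 0] by (simp add: power_mono)
    then have "(cmod (h b))\<^sup>2 * measure \<mu> UNIV \<le> B\<^sup>2 * measure \<mu> UNIV + e * (nrm h)\<^sup>2"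
      using e by (intro add_increasing2 mult_right_mono) auto
    then show ?thesis using True by (simp add: nn_integral_fock_const ennreal_mult[symmetric] ennreal_leI del: nn_integral_const)
  qed
  then show thesis by (intro that[of 0]) auto
next
  case False
  define d where "d = e * (cmod c)\<^sup>2"
  have d: "d > 0" using e False by (simp add: d_def)
  obtain R where R: "R \<ge> 0" "\<And>z. cmod z \<ge> R \<Longrightarrow> \<rho> z \<le> d * \<rho> (b + c * z)"
    using density_ratio[OF c d] by blast
  have "(\<integral>\<^sup>+z. ennreal ((cmod (h (b + c * z)))\<^sup>2) \<partial>\<mu>) \<le> ennreal (B\<^sup>2 * measure \<mu> UNIV + e * (nrm h)\<^sup>2)"
    if h: "h \<in> H" and B: "\<And>z. cmod z \<le> R \<Longrightarrow> cmod (h (b + c * z)) \<le> B" for h B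
  proof -
    note [measurable] = fock_space_measurable[OF h]
    define G where "G w = ennreal (\<rho> w) * ennreal ((cmod (h w))\<^sup>2)" for w
    have [measurable]: "G \<in> borel_measurable borel" unfolding G_def by measurable
    have "(\<integral>\<^sup>+z. ennreal ((cmod (h (b + c * z)))\<^sup>2) \<partial>\<mu>)
        = (\<integral>\<^sup>+z. ennreal (\<rho> z) * ennreal ((cmod (h (b + c * z)))\<^sup>2) \<partial>lborel)"
      by (rule nn_integral_fock) measurable
    also have "\<dots> \<le> (\<integral>\<^sup>+z. ennreal (\<rho> z) * ennreal (B\<^sup>2) + ennreal d * G (b + c * z) \<partial>lborel)"
    proof (rule nn_integral_mono)
      fix z
      show "ennreal (\<rho> z) * ennreal ((cmod (h (b + c * z)))\<^sup>2)
          \<le> ennreal (\<rho> z) * ennreal (B\<^sup>2) + ennreal d * G (b + c * z)"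
      proof (cases "cmod z \<le> R")
        case True
        then show ?thesis
          by (intro add_increasing2 mult_left_mono ennreal_leI power_mono B) auto
      next
        case False
        then have "ennreal (\<rho> z) * ennreal ((cmod (h (b + c * z)))\<^sup>2)
            \<le> ennreal (d * \<rho> (b + c * z)) * ennreal ((cmod (h (b + c * z)))\<^sup>2)"
          by (intro mult_right_mono ennreal_leI R) auto
        also have "\<dots> = ennreal d * G (b + c * z)"
          using d rho_pos[of "b + c * z"] by (simp add: G_def ennreal_mult mult.assoc)
        finally show ?thesis by (intro add_increasing) auto
      qed
    qed
    also have "\<dots> = (\<integral>\<^sup>+z. ennreal (\<rho> z) * ennreal (B\<^sup>2) \<partial>lborel) + ennreal d * (\<integral>\<^sup>+z. G (b + c * z) \<partial>lborel)"
      by (simp add: nn_integral_add nn_integral_cmult)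
    also have "(\<integral>\<^sup>+z. ennreal (\<rho> z) * ennreal (B\<^sup>2) \<partial>lborel) = ennreal (B\<^sup>2 * measure \<mu> UNIV)"
      by (simp add: nn_integral_fock[symmetric] nn_integral_fock_const ennreal_mult del: nn_integral_const)
    also have "(\<integral>\<^sup>+z. G (b + c * z) \<partial>lborel) = ennreal (1 / (cmod c)\<^sup>2) * (\<integral>\<^sup>+z. G z \<partial>lborel)"
      by (rule nn_integral_lborel_complex_affine) (use False in auto)
    also have "(\<integral>\<^sup>+z. G z \<partial>lborel) = ennreal ((nrm h)\<^sup>2)"
      unfolding G_def by (simp add: nn_integral_fock[symmetric] nn_integral_cmod_square h)
    also have "ennreal d * (ennreal (1 / (cmod c)\<^sup>2) * ennreal ((nrm h)\<^sup>2)) = ennreal (e * (nrm h)\<^sup>2)"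
      using False e by (simp add: d_def ennreal_mult[symmetric])
    finally show ?thesis using e by (simp add: ennreal_plus[symmetric] del: ennreal_plus)
  qed
  then show thesis using R(1) by (intro that[of R]) auto
qed

lemma affine_composition_in_fock_space:
  assumes c: "cmod c < 1" and h: "h \<in> H"
  shows "(\<lambda>z. h (b + c * z)) \<in> H"
proof (rule fock_spaceI)
  show "(\<lambda>z. h (b + c * z)) holomorphic_on UNIV"
    by (intro holomorphic_on_affine_argument fock_space_holomorphic h)
  obtain R where R: "R \<ge> 0"
    "\<And>h B. h \<in> H \<Longrightarrow> (\<And>z. cmod z \<le> R \<Longrightarrow> cmod (h (b + c * z)) \<le> B) \<Longrightarrow>
      (\<integral>\<^sup>+z. ennreal ((cmod (h (b + c * z)))\<^sup>2) \<partial>\<mu>) \<le> ennreal (B\<^sup>2 * measure \<mu> UNIV + 1 * (nrm h)\<^sup>2)"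
    using composition_norm_estimate[OF c zero_less_one] by blast
  have "continuous_on (cball 0 R) (\<lambda>z. h (b + c * z))"
    by (intro continuous_on_compose2[OF fock_space_continuous[OF h, of UNIV]] continuous_intros) auto
  then have "bounded ((\<lambda>z. h (b + c * z)) ` cball 0 R)"
    by (intro compact_imp_bounded compact_continuous_image) auto
  then obtain B where "\<forall>z\<in>cball 0 R. cmod (h (b + c * z)) \<le> B"
    by (auto simp: bounded_iff)
  then have "cmod (h (b + c * z)) \<le> B" if "cmod z \<le> R" for z
    using that by simp
  from R(2)[OF h this]
  have "(\<integral>\<^sup>+z. ennreal ((cmod (h (b + c * z)))\<^sup>2) \<partial>\<mu>) \<le> ennreal (B\<^sup>2 * measure \<mu> UNIV + 1 * (nrm h)\<^sup>2)"
    by simp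
  also have "\<dots> < \<infinity>" by simp
  finally show "(\<integral>\<^sup>+z. ennreal ((cmod (h (b + c * z)))\<^sup>2) \<partial>\<mu>) < \<infinity>" .
qed

lemma affine_composition_linear:
  assumes c: "cmod c < 1"
  shows "fock_linear_operator \<alpha> m (composition_operator (\<lambda>z. b + c * z))"
  using affine_composition_in_fock_space[OF c]
  by (auto simp: fock_linear_operator_def composition_operator_def o_def)

text \<open>The image \<open>S\<close> of the closed unit ball is itself compact, not only its closure: the normal family
  argument produces a limit \<open>h\<close> in the closed unit ball, and \<open>composition_norm_estimate\<close> improves
  locally uniform convergence before composing to norm convergence after composing.\<close>

lemma affine_composition_compact:
  assumes c: "cmod c < 1"
  shows "fock_compact_operator \<alpha> m (composition_operator (\<lambda>z. b + c * z))"
proof -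
  define T where "T = composition_operator (\<lambda>z. b + c * z)"
  have T: "T f = (\<lambda>z. f (b + c * z))" for f by (simp add: T_def composition_operator_def o_def)
  have TH: "T f \<in> H" if "f \<in> H" for f
    unfolding T using affine_composition_in_fock_space[OF c that] .
  interpret F: Metric_space H "fock_dist \<alpha> m"
    by (rule fock_Metric_space[OF m_pos alpha_pos])
  define S where "S = T ` {f \<in> H. nrm f \<le> 1}"
  have "compactin F.mtopology S"
    unfolding F.compactin_sequentially
  proof (intro conjI allI impI)
    show "S \<subseteq> H" using TH by (auto simp: S_def)
    fix \<sigma> :: "nat \<Rightarrow> complex \<Rightarrow> complex" assume "range \<sigma> \<subseteq> S"
    then have "\<forall>n. \<exists>f. f \<in> H \<and> nrm f \<le> 1 \<and> \<sigma> n = T f" by (auto simp: S_def)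
    then obtain f where f: "\<And>n. f n \<in> H" "\<And>n. nrm (f n) \<le> 1" "\<And>n. \<sigma> n = T (f n)" by metis
    obtain h r where h: "h \<in> H" "nrm h \<le> 1" "strict_mono (r :: nat \<Rightarrow> nat)"
      and unif: "\<And>K. compact K \<Longrightarrow> uniform_limit K (f \<circ> r) h sequentially"
      by (rule fock_montel[of f 1, OF f(1,2)]) blast
    define g where "g n z = f (r n) z - h z" for n z
    have g: "g n \<in> H" for n unfolding g_def by (intro fock_space_diff f h)
    have g2: "nrm (g n) \<le> 2" for n
    proof -
      have "nrm (g n) \<le> nrm (f (r n)) + nrm (\<lambda>z. (- 1) * h z)"
        using fock_norm_triangle[OF m_pos alpha_pos f(1) fock_space_cmult[OF h(1)], of "r n" "- 1"]
        by (simp add: g_def[abs_def])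
      also have "\<dots> \<le> 1 + 1" using f(2) h(2) by (intro add_mono) (simp_all only: fock_norm_cmult, simp)
      finally show ?thesis by simp
    qed
    have "(\<lambda>n. nrm (T (g n))) \<longlonglongrightarrow> 0"
    proof (rule LIMSEQ_I)
      fix e :: real assume e: "e > 0"
      define V where "V = measure \<mu> UNIV + 1"
      have V: "V > 0" "measure \<mu> UNIV \<le> V" by (simp_all add: V_def add_nonneg_pos)
      \<comment> \<open>Since \<open>\<parallel>g n\<parallel> \<le> 2\<close>, this choice of \<open>d\<close> and that of \<open>B\<close> below contribute \<open>e\<^sup>2 / 4\<close> each.\<close>
      define d where "d = e\<^sup>2 / 16"
      have "d > 0" using e by (simp add: d_def)
      obtain R where R: "R \<ge> 0"
        "\<And>h B. h \<in> H \<Longrightarrow> (\<And>z. cmod z \<le> R \<Longrightarrow> cmod (h (b + c * z)) \<le> B) \<Longrightarrow>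
          (\<integral>\<^sup>+z. ennreal ((cmod (h (b + c * z)))\<^sup>2) \<partial>\<mu>) \<le> ennreal (B\<^sup>2 * measure \<mu> UNIV + d * (nrm h)\<^sup>2)"
        using composition_norm_estimate[OF c \<open>d > 0\<close>] by blast
      define K where "K = (\<lambda>z. b + c * z) ` cball 0 R"
      have "compact K" unfolding K_def by (intro compact_continuous_image continuous_intros) auto
      define B where "B = e / (2 * sqrt V)"
      have B: "B > 0" using e V by (simp add: B_def)
      have "\<forall>\<^sub>F n in sequentially. \<forall>w\<in>K. dist ((f \<circ> r) n w) (h w) < B"
        using unif[OF \<open>compact K\<close>] B by (rule uniform_limitD)
      then obtain N where N: "\<And>n w. n \<ge> N \<Longrightarrow> w \<in> K \<Longrightarrow> cmod (g n w) < B"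
        by (auto simp: eventually_sequentially g_def dist_norm)
      have "nrm (T (g n)) < e" if "n \<ge> N" for n
      proof -
        have "ennreal ((nrm (T (g n)))\<^sup>2) \<le> ennreal (B\<^sup>2 * measure \<mu> UNIV + d * (nrm (g n))\<^sup>2)"
          unfolding nn_integral_cmod_square[OF TH[OF g], symmetric] unfolding T
          by (rule R(2)[OF g]) (rule less_imp_le[OF N[OF that]], unfold K_def, rule imageI, simp)
        then have "(nrm (T (g n)))\<^sup>2 \<le> B\<^sup>2 * measure \<mu> UNIV + d * (nrm (g n))\<^sup>2"
          using \<open>d > 0\<close> by (subst (asm) ennreal_le_iff) auto
        also have "\<dots> \<le> B\<^sup>2 * V + d * 2\<^sup>2"
          using V \<open>d > 0\<close> g2[of n] by (intro add_mono mult_left_mono power_mono) (auto simp: fock_norm_nonneg)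
        also have "\<dots> = e\<^sup>2 / 2"
          using V by (simp add: B_def d_def power_divide power_mult_distrib)
        also have "\<dots> < e\<^sup>2" using e by simp
        finally show ?thesis by (rule power2_less_imp_less) (use e in simp)
      qed
      then show "\<exists>N. \<forall>n\<ge>N. norm (nrm (T (g n)) - 0) < e"
        by (intro exI[of _ N]) (auto simp: fock_norm_nonneg)
    qed
    moreover have "fock_dist \<alpha> m (\<sigma> (r n)) (T h) = nrm (T (g n))" for n
      by (simp add: fock_dist_def f(3) T g_def)
    ultimately have "limitin F.mtopology (\<sigma> \<circ> r) (T h) sequentially"
      using f TH h by (auto simp: F.limitin_metric_dist_null o_def)
    then show "\<exists>l r. l \<in> S \<and> strict_mono r \<and> limitin F.mtopology (\<sigma> \<circ> r) l sequentially"
      using h by (auto simp: S_def)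
  qed
  moreover from this have "closedin F.mtopology S"
    by (rule compactin_imp_closedin[OF F.Hausdorff_space_mtopology])
  ultimately show ?thesis
    unfolding fock_compact_operator_def fock_topology_def T_def[symmetric] S_def[symmetric]
    using affine_composition_linear[OF c, of b] by (simp add: closure_of_closedin T_def)
qed


section \<open>The monomial basis and the Hilbert-Schmidt property\<close>

definition monomial_norm :: "nat \<Rightarrow> real" where
  "monomial_norm n = nrm (\<lambda>z. z ^ n)"

definition unit_monomial :: "nat \<Rightarrow> complex \<Rightarrow> complex" where
  "unit_monomial n z = complex_of_real (1 / monomial_norm n) * z ^ n"

lemma monomial_norm_pos: "monomial_norm n > 0"
proof -
  have "(\<lambda>z::complex. z ^ n) \<noteq> (\<lambda>z. 0)" by (metis power_one zero_neq_one)
  then show ?thesis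
    using fock_norm_zero_iff[OF m_pos alpha_pos monomial_in_fock_space, of n] fock_norm_nonneg[of \<alpha> m "\<lambda>z. z ^ n"]
    by (simp add: monomial_norm_def)
qed

lemma unit_monomial_in_fock_space: "unit_monomial n \<in> H"
  unfolding unit_monomial_def[abs_def] by (rule fock_space_cmult[OF monomial_in_fock_space])

lemma fock_inner_cmult_right: "ip f (\<lambda>z. a * g z) = cnj a * ip f g"
  unfolding fock_inner_commute[of f] fock_inner_cmult by simp

lemma fock_inner_unit_monomial: "ip f (unit_monomial n) = ip f (\<lambda>z. z ^ n) / complex_of_real (monomial_norm n)"
  unfolding unit_monomial_def[abs_def] fock_inner_cmult_right by simp

lemma unit_monomial_orthonormal: "ip (unit_monomial j) (unit_monomial k) = (if j = k then 1 else 0)"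
proof (cases "j = k")
  case True
  have "nrm (unit_monomial k) = 1"
    using monomial_norm_pos[of k] unfolding unit_monomial_def[abs_def] fock_norm_cmult
    by (simp add: monomial_norm_def[symmetric] norm_divide)
  then show ?thesis using True by (simp add: fock_inner_self)
next
  case False
  then have "ip (\<lambda>z. z ^ j) (\<lambda>z. z ^ k) = 0"
    using rotation_invariant_orthogonal[OF rotation_invariant_fock, where h = "\<lambda>_. 1" and n = j and k = k]
    by (simp add: fock_inner_def)
  then show ?thesis
    using False unfolding fock_inner_unit_monomial unfolding unit_monomial_def[abs_def] fock_inner_cmult by simp
qed

lemma inj_unit_monomial: "inj unit_monomial"
  using unit_monomial_orthonormal by (intro injI) (metis zero_neq_one)

text \<open>A function orthogonal to all monomials has vanishing Taylor coefficients.\<close>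

lemma unit_monomial_orthonormal_basis: "fock_orthonormal_basis \<alpha> m (range unit_monomial)"
  unfolding fock_orthonormal_basis_def
proof (intro conjI ballI impI)
  show "range unit_monomial \<subseteq> H" using unit_monomial_in_fock_space by blast
  show "ip x y = (if x = y then 1 else 0)" if "x \<in> range unit_monomial" "y \<in> range unit_monomial" for x y
    using that unit_monomial_orthonormal by auto
  fix f assume f: "f \<in> H" and 0: "\<forall>x\<in>range unit_monomial. ip f x = 0"
  have "(deriv ^^ n) f 0 = 0" for n
  proof -
    have "ip f (unit_monomial n) = 0" using 0 by blast
    then have "ip f (\<lambda>z. z ^ n) = 0"
      unfolding fock_inner_unit_monomial using monomial_norm_pos[of n] by simp
    then show ?thesis
      using fock_inner_monomial[OF f, of n] monomial_norm_pos[of n] by (simp add: monomial_norm_def)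
  qed
  moreover have "(\<lambda>n. (deriv ^^ n) f 0 / fact n * (z - 0) ^ n) sums f z" for z
    using holomorphic_on_subset[OF fock_space_holomorphic[OF f]]
    by (intro holomorphic_power_series[of f 0 "cmod z + 1"]) auto
  ultimately have "f z = 0" for z by (simp add: sums_iff)
  then show "f = (\<lambda>z. 0)" by blast
qed

text \<open>The constant \<open>t\<close> is the mass outside the disc of radius \<open>R\<close>, where \<open>|z\<^sup>n|\<^sup>2 \<ge> R\<^sup>2\<^sup>n\<close>. Hence the norms of
  the monomials eventually exceed every geometric sequence, which takes the place of their exact
  values in terms of the Gamma function.\<close>

lemma monomial_norm_lower:
  assumes "R \<ge> 0"
  obtains t where "t > 0" "\<And>n. t * R ^ (2 * n) \<le> (monomial_norm n)\<^sup>2"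
proof -
  define A :: "complex set" where "A = - cball 0 R"
  have [measurable]: "A \<in> sets borel" by (simp add: A_def)
  have A: "A \<in> sets \<mu>" by (simp add: sets_fock_measure)
  have fin: "emeasure \<mu> A \<noteq> \<infinity>"
    using finite_measure.emeasure_finite[OF finite_measure_fock] by simp
  have "measure \<mu> A \<noteq> 0"
  proof
    assume "measure \<mu> A = 0"
    then have "emeasure \<mu> A = 0"
      using finite_measure.emeasure_eq_measure[OF finite_measure_fock, of A] by simp
    then have "AE z in \<mu>. z \<notin> A" using A by (subst AE_iff_null_sets[symmetric]) auto
    then have "AE z in lborel. z \<notin> A"
      unfolding fock_measure_def using rho_pos by (subst (asm) AE_density) auto
    then have "AE z in lebesgue. z \<in> cball (0::complex) R"
      by (auto simp: A_def intro: AE_completion)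
    then have "z \<in> cball 0 R" for z :: complex
      by (rule mem_closed_if_AE_lebesgue[OF closed_cball])
    from this[of "of_real (R + 1)"] show False using assms by (simp add: norm_of_real del: of_real_add)
  qed
  then have pos: "measure \<mu> A > 0" using measure_nonneg[of \<mu> A] by linarith
  have "measure \<mu> A * R ^ (2 * n) \<le> (monomial_norm n)\<^sup>2" for n
  proof -
    have "measure \<mu> A * R ^ (2 * n) = (LINT z|\<mu>. indicator A z * R ^ (2 * n))" by simp
    also have "\<dots> \<le> (LINT z|\<mu>. (cmod (z ^ n))\<^sup>2)"
    proof (rule integral_mono)
      show "integrable \<mu> (\<lambda>z. indicator A z * R ^ (2 * n) :: real)"
        using A fin by (intro integrable_mult_left integrable_real_indicator) (auto simp: less_top)
      show "integrable \<mu> (\<lambda>z. (cmod (z ^ n))\<^sup>2)"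
        by (rule fock_space_integrable[OF monomial_in_fock_space])
      show "indicator A z * R ^ (2 * n) \<le> (cmod (z ^ n))\<^sup>2" for z
        using assms by (auto simp: indicator_def A_def norm_power power_mult[symmetric] mult.commute intro!: power_mono)
    qed
    finally show ?thesis by (simp add: monomial_norm_def fock_norm_square)
  qed
  with pos show thesis by (rule that)
qed

text \<open>Expanding the maximum in \<open>|b + c z| \<le> q max |z| R\<close>, the norm of \<open>(b + c z)\<^sup>n\<close> squared is at most
  \<open>q\<^sup>2\<^sup>n\<close> times \<open>\<parallel>z\<^sup>n\<parallel>\<^sup>2\<close> plus \<open>R\<^sup>2\<^sup>n\<close> times the total mass, and the second contribution is absorbed in the
  first by \<open>monomial_norm_lower\<close>. So the squared norms of the images of the basis decay like \<open>q\<^sup>2\<^sup>n\<close>.\<close>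

lemma affine_composition_Hilbert_Schmidt:
  assumes c: "cmod c < 1"
  shows "fock_Hilbert_Schmidt_operator \<alpha> m (composition_operator (\<lambda>z. b + c * z))"
proof -
  define T where "T = composition_operator (\<lambda>z. b + c * z)"
  have T: "T f = (\<lambda>z. f (b + c * z))" for f by (simp add: T_def composition_operator_def o_def)
  obtain q R where q: "0 < q" "q < 1" "R \<ge> 0" and le: "\<And>z. cmod (b + c * z) \<le> q * max (cmod z) R"
    using affine_contraction_bound[OF c] by blast
  obtain t where t: "t > 0" "\<And>n. t * R ^ (2 * n) \<le> (monomial_norm n)\<^sup>2"
    using monomial_norm_lower[OF q(3)] by blast
  define C where "C = measure \<mu> UNIV / t + 1"
  have bound: "(nrm (T (unit_monomial n)))\<^sup>2 \<le> C * (q\<^sup>2) ^ n" for n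
  proof -
    have sp: "space \<mu> = UNIV" by (simp add: fock_measure_def)
    have int: "integrable \<mu> (\<lambda>z. (cmod (z ^ n))\<^sup>2)"
      by (rule fock_space_integrable[OF monomial_in_fock_space])
    have "(nrm (\<lambda>z. (b + c * z) ^ n))\<^sup>2 \<le> (LINT z|\<mu>. (q\<^sup>2) ^ n * R ^ (2 * n) + (q\<^sup>2) ^ n * (cmod (z ^ n))\<^sup>2)"
      unfolding fock_norm_square
    proof (rule integral_mono)
      show "integrable \<mu> (\<lambda>z. (cmod ((b + c * z) ^ n))\<^sup>2)"
        using affine_composition_in_fock_space[OF c monomial_in_fock_space, of b n]
        by (rule fock_space_integrable)
      show "integrable \<mu> (\<lambda>z. (q\<^sup>2) ^ n * R ^ (2 * n) + (q\<^sup>2) ^ n * (cmod (z ^ n))\<^sup>2)"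
        by (intro Bochner_Integration.integrable_add integrable_mult_right int
            finite_measure.integrable_const[OF finite_measure_fock])
      fix z
      have "(cmod ((b + c * z) ^ n))\<^sup>2 = cmod (b + c * z) ^ (2 * n)"
        by (simp add: norm_power power_mult[symmetric] mult.commute)
      also have "\<dots> \<le> (q * max (cmod z) R) ^ (2 * n)" by (intro power_mono le) simp
      also have "\<dots> = (q\<^sup>2) ^ n * max (cmod z) R ^ (2 * n)" by (simp add: power_mult_distrib power_mult)
      also have "max (cmod z) R ^ (2 * n) \<le> R ^ (2 * n) + cmod z ^ (2 * n)"
        by (simp add: max_def)
      also have "cmod z ^ (2 * n) = (cmod (z ^ n))\<^sup>2"
        by (simp add: norm_power power_mult[symmetric] mult.commute)
      finally show "(cmod ((b + c * z) ^ n))\<^sup>2 \<le> (q\<^sup>2) ^ n * R ^ (2 * n) + (q\<^sup>2) ^ n * (cmod (z ^ n))\<^sup>2"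
        by (simp add: distrib_left mult_left_mono)
    qed
    also have "\<dots> = (q\<^sup>2) ^ n * (R ^ (2 * n) * measure \<mu> UNIV + (monomial_norm n)\<^sup>2)"
    proof -
      have "(LINT z|\<mu>. (q\<^sup>2) ^ n * R ^ (2 * n) + (q\<^sup>2) ^ n * (cmod (z ^ n))\<^sup>2)
          = (LINT z|\<mu>. (q\<^sup>2) ^ n * R ^ (2 * n)) + (LINT z|\<mu>. (q\<^sup>2) ^ n * (cmod (z ^ n))\<^sup>2)"
        by (intro Bochner_Integration.integral_add integrable_mult_right int
            finite_measure.integrable_const[OF finite_measure_fock])
      then show ?thesis
        by (simp add: monomial_norm_def fock_norm_square sp algebra_simps)
    qed
    also have "\<dots> \<le> (q\<^sup>2) ^ n * (C * (monomial_norm n)\<^sup>2)"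
    proof (rule mult_left_mono)
      have "R ^ (2 * n) \<le> (monomial_norm n)\<^sup>2 / t"
        using t by (simp add: pos_le_divide_eq mult.commute)
      then have "R ^ (2 * n) * measure \<mu> UNIV \<le> (monomial_norm n)\<^sup>2 / t * measure \<mu> UNIV"
        by (rule mult_right_mono) simp
      then show "R ^ (2 * n) * measure \<mu> UNIV + (monomial_norm n)\<^sup>2 \<le> C * (monomial_norm n)\<^sup>2"
        by (simp add: C_def algebra_simps)
    qed simp
    finally have *: "(nrm (\<lambda>z. (b + c * z) ^ n))\<^sup>2 \<le> (q\<^sup>2) ^ n * (C * (monomial_norm n)\<^sup>2)" .
    have "nrm (T (unit_monomial n)) = nrm (\<lambda>z. (b + c * z) ^ n) / monomial_norm n"
      using monomial_norm_pos[of n] unfolding T unit_monomial_def fock_norm_cmult by (simp add: norm_divide)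
    then have "(nrm (T (unit_monomial n)))\<^sup>2 = (nrm (\<lambda>z. (b + c * z) ^ n))\<^sup>2 / (monomial_norm n)\<^sup>2"
      by (simp add: power_divide)
    also have "\<dots> \<le> (q\<^sup>2) ^ n * (C * (monomial_norm n)\<^sup>2) / (monomial_norm n)\<^sup>2"
      by (rule divide_right_mono[OF *]) simp
    also have "\<dots> = C * (q\<^sup>2) ^ n" using monomial_norm_pos[of n] by simp
    finally show ?thesis .
  qed
  have "summable (\<lambda>n. C * (q\<^sup>2) ^ n)"
    using q by (intro summable_mult summable_geometric) (simp add: power_less_one_iff abs_square_less_1)
  then have "summable (\<lambda>n. norm ((nrm (T (unit_monomial n)))\<^sup>2))"
    by (rule summable_comparison_test'[where N = 0]) (use bound in simp)
  then have "(\<lambda>n. (nrm (T (unit_monomial n)))\<^sup>2) summable_on UNIV"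
    by (rule norm_summable_imp_summable_on)
  then have "(\<lambda>f. (nrm (T f))\<^sup>2) summable_on range unit_monomial"
    using summable_on_reindex[OF inj_unit_monomial, of "\<lambda>f. (nrm (T f))\<^sup>2"] by (simp add: o_def)
  then show ?thesis
    unfolding fock_Hilbert_Schmidt_operator_def
    using affine_composition_linear[OF c] unit_monomial_orthonormal_basis by (auto simp: T_def)
qed

section \<open>Necessity of contraction\<close>

text \<open>By the binomial theorem the coefficient of \<open>e\<^sub>n\<close> in \<open>e\<^sub>n \<circ> \<phi>\<close> is \<open>c\<^sup>n\<close>, whatever \<open>b\<close> is, and a coefficient
  is at most the norm.\<close>

lemma composed_unit_monomial_norm_lower:
  assumes Te: "(\<lambda>z. unit_monomial n (b + c * z)) \<in> H"
  shows "cmod c ^ n \<le> nrm (\<lambda>z. unit_monomial n (b + c * z))"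
proof -
  define a where "a = complex_of_real (1 / monomial_norm n)"
  have "unit_monomial n (b + c * z) = (\<Sum>k\<le>n. (a * (of_nat (n choose k) * c ^ k * b ^ (n - k)) * complex_of_real (monomial_norm k)) * unit_monomial k z)" for z
  proof -
    have "(c * z + b) ^ n = (\<Sum>k\<le>n. of_nat (n choose k) * (c * z) ^ k * b ^ (n - k))"
      by (rule binomial_ring)
    then have "unit_monomial n (b + c * z) = (\<Sum>k\<le>n. a * (of_nat (n choose k) * (c * z) ^ k * b ^ (n - k)))"
      by (simp add: unit_monomial_def a_def add.commute sum_distrib_left)
    also have "\<dots> = (\<Sum>k\<le>n. (a * (of_nat (n choose k) * c ^ k * b ^ (n - k)) * complex_of_real (monomial_norm k)) * unit_monomial k z)"
    proof (rule sum.cong)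
      fix k
      show "a * (of_nat (n choose k) * (c * z) ^ k * b ^ (n - k))
          = (a * (of_nat (n choose k) * c ^ k * b ^ (n - k)) * complex_of_real (monomial_norm k)) * unit_monomial k z"
        using monomial_norm_pos[of k] by (simp add: unit_monomial_def power_mult_distrib)
    qed simp
    finally show ?thesis .
  qed
  then have "ip (\<lambda>z. unit_monomial n (b + c * z)) (unit_monomial n)
      = (\<Sum>k\<le>n. (a * (of_nat (n choose k) * c ^ k * b ^ (n - k)) * complex_of_real (monomial_norm k)) * ip (unit_monomial k) (unit_monomial n))"
    by (simp only: fock_inner_sum[OF unit_monomial_in_fock_space unit_monomial_in_fock_space])
  also have "\<dots> = c ^ n"
    using monomial_norm_pos[of n]
    by (simp add: unit_monomial_orthonormal a_def if_distrib[of "\<lambda>x. _ * x"] cong: if_cong)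
  finally have "cmod c ^ n = cmod (ip (\<lambda>z. unit_monomial n (b + c * z)) (unit_monomial n))"
    by (simp add: norm_power)
  also have "\<dots> \<le> nrm (\<lambda>z. unit_monomial n (b + c * z))"
    by (intro fock_inner_le_norm Te unit_monomial_in_fock_space) (simp add: unit_monomial_orthonormal)
  finally show ?thesis .
qed

text \<open>With \<open>R > 2 |w|\<close> in \<open>monomial_norm_lower\<close>, the values decay at least like \<open>2\<^sup>-\<^sup>n\<close>.\<close>

lemma unit_monomial_tendsto_zero: "(\<lambda>n. unit_monomial n w) \<longlonglongrightarrow> 0"
proof -
  define R where "R = 2 * cmod w + 1"
  have R: "R > 0" by (simp add: R_def add_nonneg_pos)
  obtain t where t: "t > 0" "\<And>n. t * R ^ (2 * n) \<le> (monomial_norm n)\<^sup>2"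
    using monomial_norm_lower[of R] R by auto
  have "cmod (unit_monomial n w) \<le> (1 / sqrt t) * (1 / 2) ^ n" for n
  proof -
    have "sqrt t * R ^ n \<le> monomial_norm n"
    proof (rule power2_le_imp_le)
      show "(sqrt t * R ^ n)\<^sup>2 \<le> (monomial_norm n)\<^sup>2"
        using t(1) t(2)[of n] by (simp add: power_mult_distrib power_mult[symmetric] mult.commute)
    qed (use monomial_norm_pos[of n] in simp)
    then have "cmod w ^ n / monomial_norm n \<le> cmod w ^ n / (sqrt t * R ^ n)"
      using t R monomial_norm_pos[of n] by (intro divide_left_mono) auto
    also have "\<dots> = (1 / sqrt t) * (cmod w / R) ^ n" by (simp add: power_divide)
    also have "\<dots> \<le> (1 / sqrt t) * (1 / 2) ^ n"
      using t R by (intro mult_left_mono power_mono) (auto simp: R_def field_simps)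
    finally show ?thesis
      using monomial_norm_pos[of n] by (simp add: unit_monomial_def norm_mult norm_divide norm_power)
  qed
  moreover have "(\<lambda>n. (1 / sqrt t) * (1 / 2) ^ n) \<longlonglongrightarrow> 0"
    by (intro tendsto_mult_right_zero LIMSEQ_power_zero) simp
  ultimately show ?thesis
    by (rule Lim_null_comparison[OF always_eventually[OF allI]])
qed

text \<open>A subsequence of the images of the \<open>e\<^sub>n\<close> converges in norm to some \<open>g\<close>. Their pointwise limit is zero,
  so \<open>g = 0\<close>, although the norms are at least 1.\<close>

lemma affine_composition_compact_imp:
  assumes compact: "fock_compact_operator \<alpha> m (composition_operator (\<lambda>z. b + c * z))"
  shows "cmod c < 1"
proof (rule ccontr)
  assume "\<not> cmod c < 1"
  define T where "T = composition_operator (\<lambda>z. b + c * z)"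
  have T: "T f = (\<lambda>z. f (b + c * z))" for f by (simp add: T_def composition_operator_def o_def)
  have TH: "T f \<in> H" if "f \<in> H" for f
    using that compact by (auto simp: fock_compact_operator_def fock_linear_operator_def T_def)
  interpret F: Metric_space H "fock_dist \<alpha> m"
    by (rule fock_Metric_space[OF m_pos alpha_pos])
  define S where "S = F.mtopology closure_of (T ` {f \<in> H. nrm f \<le> 1})"
  have "compactin F.mtopology S"
    using compact by (simp add: fock_compact_operator_def fock_topology_def S_def T_def)
  moreover have "range (\<lambda>n. T (unit_monomial n)) \<subseteq> S"
  proof -
    have "nrm (unit_monomial n) = 1" for n
      using unit_monomial_orthonormal[of n n] fock_norm_nonneg[of \<alpha> m "unit_monomial n"]
      by (simp only: fock_inner_self of_real_eq_1_iff simp_thms if_True) (simp add: power2_eq_1_iff)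
    then have "range (\<lambda>n. T (unit_monomial n)) \<subseteq> T ` {f \<in> H. nrm f \<le> 1}"
      using unit_monomial_in_fock_space by auto
    also have "\<dots> \<subseteq> S"
      unfolding S_def by (rule closure_of_subset) (use TH in auto)
    finally show ?thesis .
  qed
  ultimately obtain g r where g: "strict_mono (r :: nat \<Rightarrow> nat)"
    "limitin F.mtopology ((\<lambda>n. T (unit_monomial n)) \<circ> r) g sequentially"
    unfolding F.compactin_sequentially by blast
  then have gH: "g \<in> H" and lim: "(\<lambda>n. nrm (\<lambda>z. T (unit_monomial (r n)) z - g z)) \<longlonglongrightarrow> 0"
    by (simp_all add: F.limitin_metric_dist_null o_def fock_dist_def)
  have diff: "(\<lambda>z. T (unit_monomial (r n)) z - g z) \<in> H" for n
    by (intro fock_space_diff TH unit_monomial_in_fock_space gH)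
  have "g w = 0" for w
  proof -
    obtain C where C: "C > 0" "\<And>f z. f \<in> H \<Longrightarrow> cmod z \<le> cmod w \<Longrightarrow> cmod (f z) \<le> C * nrm f"
      by (rule fock_point_evaluation[OF norm_ge_zero[of w]]) blast
    have "(\<lambda>n. T (unit_monomial (r n)) w - g w) \<longlonglongrightarrow> 0"
    proof (rule Lim_null_comparison)
      show "\<forall>\<^sub>F n in sequentially. cmod (T (unit_monomial (r n)) w - g w) \<le> C * nrm (\<lambda>z. T (unit_monomial (r n)) z - g z)"
        by (intro always_eventually allI C(2)[OF diff]) simp
      show "(\<lambda>n. C * nrm (\<lambda>z. T (unit_monomial (r n)) z - g z)) \<longlonglongrightarrow> 0"
        by (rule tendsto_mult_right_zero[OF lim])
    qed
    moreover have "(\<lambda>n. T (unit_monomial (r n)) w) \<longlonglongrightarrow> 0"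
      using LIMSEQ_subseq_LIMSEQ[OF unit_monomial_tendsto_zero[of "b + c * w"] g(1)] by (simp add: T o_def)
    ultimately have "(\<lambda>n. g w) \<longlonglongrightarrow> 0 - 0"
      using tendsto_diff[of "\<lambda>n. T (unit_monomial (r n)) w" 0 sequentially "\<lambda>n. T (unit_monomial (r n)) w - g w" 0] by simp
    then show ?thesis by (simp add: LIMSEQ_const_iff)
  qed
  then have "(\<lambda>n. nrm (T (unit_monomial (r n)))) \<longlonglongrightarrow> 0" using lim by simp
  moreover have "1 \<le> nrm (T (unit_monomial k))" for k
  proof -
    have "1 \<le> cmod c ^ k" using \<open>\<not> cmod c < 1\<close> by (intro one_le_power) simp
    also have "\<dots> \<le> nrm (T (unit_monomial k))"
      unfolding T by (rule composed_unit_monomial_norm_lower) (use TH[OF unit_monomial_in_fock_space] in \<open>simp add: T\<close>)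
    finally show ?thesis .
  qed
  ultimately have "(1::real) \<le> 0" by (intro LIMSEQ_le_const) auto
  then show False by simp
qed


text \<open>The Cauchy-Schwarz inequality for the expansion of \<open>g w\<close>, together with Bessel's inequality.\<close>

lemma point_value_le_basis_sum:
  assumes u: "orthonormal_or_zero u" and g: "g \<in> H"
    and maximal: "\<And>f. f \<in> H \<Longrightarrow> (\<And>k. ip f (u k) = 0) \<Longrightarrow> f = (\<lambda>z. 0)"
  shows "ennreal ((cmod (g w))\<^sup>2) \<le> ennreal ((nrm g)\<^sup>2) * (\<Sum>k. ennreal ((cmod (u k w))\<^sup>2))"
proof (rule LIMSEQ_le_const2)
  define s where "s K = (\<Sum>k<K. ip g (u k) * u k w)" for K
  have "(\<lambda>k. ip g (u k) * u k w) sums g w"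
    by (rule fock_expansion[OF u g]) (rule maximal)
  then have "s \<longlonglongrightarrow> g w" by (simp add: s_def[abs_def] sums_def)
  then show "(\<lambda>K. ennreal ((cmod (s K))\<^sup>2)) \<longlonglongrightarrow> ennreal ((cmod (g w))\<^sup>2)"
    by (intro tendsto_ennrealI tendsto_power tendsto_norm)
  have "ennreal ((cmod (s K))\<^sup>2) \<le> ennreal ((nrm g)\<^sup>2) * (\<Sum>k. ennreal ((cmod (u k w))\<^sup>2))" for K
  proof -
    have "cmod (s K) \<le> (\<Sum>k<K. cmod (ip g (u k)) * cmod (u k w))"
      unfolding s_def by (rule order_trans[OF norm_sum]) (simp add: norm_mult)
    then have "(cmod (s K))\<^sup>2 \<le> (\<Sum>k<K. cmod (ip g (u k)) * cmod (u k w))\<^sup>2"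
      by (rule power_mono) simp
    also have "\<dots> \<le> (\<Sum>k<K. (cmod (ip g (u k)))\<^sup>2) * (\<Sum>k<K. (cmod (u k w))\<^sup>2)"
      by (rule Cauchy_Schwarz_ineq_sum)
    also have "\<dots> \<le> (nrm g)\<^sup>2 * (\<Sum>k<K. (cmod (u k w))\<^sup>2)"
      by (intro mult_right_mono fock_bessel u g sum_nonneg) auto
    finally have "ennreal ((cmod (s K))\<^sup>2) \<le> ennreal ((nrm g)\<^sup>2) * (\<Sum>k<K. ennreal ((cmod (u k w))\<^sup>2))"
      by (simp add: ennreal_leI sum_nonneg flip: ennreal_mult)
    also have "\<dots> \<le> ennreal ((nrm g)\<^sup>2) * (\<Sum>k. ennreal ((cmod (u k w))\<^sup>2))"
      by (intro mult_left_mono sum_le_suminf) auto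
    finally show ?thesis .
  qed
  then show "\<exists>N. \<forall>K\<ge>N. ennreal ((cmod (s K))\<^sup>2) \<le> ennreal ((nrm g)\<^sup>2) * (\<Sum>k. ennreal ((cmod (u k w))\<^sup>2))"
    by blast
qed

text \<open>The function \<open>g\<close> is the kernel of the span of the first \<open>N\<close> monomials at \<open>w\<close>, for which \<open>g w\<close> and the
  squared norm of \<open>g\<close> are both the left-hand side \<open>K\<close>. The preceding lemma then reads \<open>K\<^sup>2 \<le> K \<cdot> S\<close>, with
  \<open>S\<close> the right-hand side.\<close>

lemma monomial_kernel_le_basis_sum:
  assumes u: "orthonormal_or_zero u"
    and maximal: "\<And>f. f \<in> H \<Longrightarrow> (\<And>k. ip f (u k) = 0) \<Longrightarrow> f = (\<lambda>z. 0)"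
  shows "(\<Sum>n<N. ennreal ((cmod (unit_monomial n w))\<^sup>2)) \<le> (\<Sum>k. ennreal ((cmod (u k w))\<^sup>2))"
proof -
  define K where "K = (\<Sum>n<N. (cmod (unit_monomial n w))\<^sup>2)"
  define g where "g z = (\<Sum>n<N. cnj (unit_monomial n w) * unit_monomial n z)" for z
  have K0: "K \<ge> 0" by (simp add: K_def sum_nonneg)
  have gH: "g \<in> H" unfolding g_def by (intro fock_space_sum unit_monomial_in_fock_space)
  have ip: "ip g h = (\<Sum>n<N. cnj (unit_monomial n w) * ip (unit_monomial n) h)" if "h \<in> H" for h
    unfolding g_def by (intro fock_inner_sum unit_monomial_in_fock_space that)
  have "ip (unit_monomial n) g = unit_monomial n w" if "n < N" for n
  proof -
    have "ip g (unit_monomial n) = (\<Sum>k<N. if k = n then cnj (unit_monomial n w) else 0)"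
      unfolding ip[OF unit_monomial_in_fock_space] unit_monomial_orthonormal by (intro sum.cong) auto
    also have "\<dots> = cnj (unit_monomial n w)" using that by simp
    finally show ?thesis by (subst fock_inner_commute) simp
  qed
  then have "ip g g = (\<Sum>n<N. cnj (unit_monomial n w) * unit_monomial n w)"
    unfolding ip[OF gH] by (intro sum.cong) auto
  also have gw: "(\<Sum>n<N. cnj (unit_monomial n w) * unit_monomial n w) = complex_of_real K"
    unfolding K_def of_real_sum by (intro sum.cong refl) (simp only: complex_norm_square mult.commute)
  finally have norm: "(nrm g)\<^sup>2 = K" by (simp only: fock_inner_self of_real_eq_iff)
  have "g w = complex_of_real K" using gw by (simp add: g_def)
  then have "(cmod (g w))\<^sup>2 = K * K" by (simp add: power2_eq_square norm_mult)
  moreover have "ennreal ((cmod (g w))\<^sup>2) \<le> ennreal ((nrm g)\<^sup>2) * (\<Sum>k. ennreal ((cmod (u k w))\<^sup>2))"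
    by (rule point_value_le_basis_sum[OF u gH]) (rule maximal)
  ultimately have *: "ennreal K * ennreal K \<le> ennreal K * (\<Sum>k. ennreal ((cmod (u k w))\<^sup>2))"
    by (simp only: norm ennreal_mult[OF K0 K0])
  have "ennreal K \<le> (\<Sum>k. ennreal ((cmod (u k w))\<^sup>2))"
  proof (cases "K = 0")
    case False
    then have "ennreal K \<noteq> 0" using K0 by (simp add: ennreal_eq_0_iff)
    from iffD1[OF ennreal_mult_le_mult_iff[OF this ennreal_neq_top] *] show ?thesis .
  qed simp
  moreover have "(\<Sum>n<N. ennreal ((cmod (unit_monomial n w))\<^sup>2)) = ennreal K"
    unfolding K_def by (rule sum_ennreal) simp
  ultimately show ?thesis by simp
qed

text \<open>For \<open>|c| \<ge> 1\<close> the operator is injective, so no basis vector contributes a zero term to the summable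
  family of squared norms. Hence the basis is countable and can be written as a sequence \<open>u\<close>, padded by
  zeros if necessary. Integrating \<open>monomial_kernel_le_basis_sum\<close> along \<open>\<phi>\<close> bounds every natural number
  by the sum of the family.\<close>

lemma affine_composition_Hilbert_Schmidt_imp:
  assumes HS: "fock_Hilbert_Schmidt_operator \<alpha> m (composition_operator (\<lambda>z. b + c * z))"
  shows "cmod c < 1"
proof (rule ccontr)
  assume c: "\<not> cmod c < 1"
  then have "c \<noteq> 0" by auto
  define T where "T = composition_operator (\<lambda>z. b + c * z)"
  have T: "T f = (\<lambda>z. f (b + c * z))" for f by (simp add: T_def composition_operator_def o_def)
  have TH: "T f \<in> H" if "f \<in> H" for f
    using that HS by (auto simp: fock_Hilbert_Schmidt_operator_def fock_linear_operator_def T_def)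
  obtain B where B: "fock_orthonormal_basis \<alpha> m B" and sum: "(\<lambda>f. (nrm (T f))\<^sup>2) summable_on B"
    using HS by (auto simp: fock_Hilbert_Schmidt_operator_def T_def)
  have BH: "f \<in> H" if "f \<in> B" for f using B that by (auto simp: fock_orthonormal_basis_def)
  have orth: "ip f g = (if f = g then 1 else 0)" if "f \<in> B" "g \<in> B" for f g
    using B that by (simp add: fock_orthonormal_basis_def)
  have "(nrm (T f))\<^sup>2 \<noteq> 0" if "f \<in> B" for f
  proof
    assume "(nrm (T f))\<^sup>2 = 0"
    then have "T f = (\<lambda>z. 0)"
      using fock_norm_zero_iff[OF m_pos alpha_pos TH[OF BH[OF that]]] by simp
    then have "f (b + c * ((w - b) / c)) = 0" for w
      unfolding T by (rule fun_cong)
    then have "f w = 0" for w using \<open>c \<noteq> 0\<close> by simp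
    then show False using orth[OF that that] by (simp add: fock_inner_def)
  qed
  then have "{f \<in> B. (nrm (T f))\<^sup>2 \<noteq> 0} = B" by blast
  then have "countable B" using summable_countable_real[OF sum] by (simp only:)
  then have "bij_betw (from_nat_into B) (to_nat_on B ` B) B"
    by (intro bij_betwI[where g = "to_nat_on B"]) auto
  then obtain I and p :: "nat \<Rightarrow> complex \<Rightarrow> complex" where bij: "bij_betw p I B" by blast
  define u where "u k = (if k \<in> I then p k else (\<lambda>z. 0))" for k
  have uB: "u k \<in> B" if "k \<in> I" for k
    using that bij_betwE[OF bij] by (simp add: u_def)
  have u_inj: "j = k" if "u j = u k" "j \<in> I" "k \<in> I" for j k
  proof (rule inj_onD[OF bij_betw_imp_inj_on[OF bij]])
    show "p j = p k" using that by (simp add: u_def)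
  qed (rule that)+
  have surj: "\<exists>k. u k = f" if "f \<in> B" for f
  proof -
    have "f \<in> p ` I" using \<open>f \<in> B\<close> bij_betw_imp_surj_on[OF bij] by simp
    then obtain k where "k \<in> I" "p k = f" by blast
    then show ?thesis by (intro exI[of _ k]) (simp add: u_def)
  qed
  have zero: "u k = (\<lambda>z. 0)" if "k \<notin> I" for k using that by (simp add: u_def)
  have ip0: "ip (\<lambda>z. 0) f = 0" "ip f (\<lambda>z. 0) = 0" for f by (simp_all add: fock_inner_def)
  have uH: "u k \<in> H" for k
  proof (cases "k \<in> I")
    case True
    then show ?thesis by (intro BH uB)
  next
    case False
    then show ?thesis using zero_in_fock_space by (simp add: zero[OF False])
  qed
  have u: "orthonormal_or_zero u"
    unfolding orthonormal_or_zero_def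
  proof (intro conjI allI impI)
    show "u k \<in> H" for k by (rule uH)
    show "ip (u k) (u k) = 1 \<or> ip (u k) (u k) = 0" for k
    proof (cases "k \<in> I")
      case True
      then show ?thesis using orth[OF uB uB, of k k] by simp
    next
      case False
      then show ?thesis by (simp add: zero[OF False] ip0)
    qed
    show "ip (u j) (u k) = 0" if "j \<noteq> k" for j k
    proof (cases "j \<in> I \<and> k \<in> I")
      case True
      then have "u j \<noteq> u k" using u_inj \<open>j \<noteq> k\<close> by blast
      then show ?thesis using orth[OF uB uB, of j k] True by simp
    next
      case False
      then have "u j = (\<lambda>z. 0) \<or> u k = (\<lambda>z. 0)" using zero by blast
      then show ?thesis by (elim disjE) (simp_all add: ip0)
    qed
  qed
  have maximal: "f = (\<lambda>z. 0)" if "f \<in> H" "\<And>k. ip f (u k) = 0" for f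
  proof -
    have "ip f g = 0" if "g \<in> B" for g
      using surj[OF that] \<open>\<And>k. ip f (u k) = 0\<close> by blast
    then show ?thesis
      using B \<open>f \<in> H\<close> by (simp add: fock_orthonormal_basis_def)
  qed
  have "(\<lambda>k. (nrm (T (p k)))\<^sup>2) summable_on I"
    using summable_on_reindex_bij_betw[OF bij, of "\<lambda>f. (nrm (T f))\<^sup>2"] sum by simp
  also have "(\<lambda>k. (nrm (T (p k)))\<^sup>2) summable_on I \<longleftrightarrow> (\<lambda>k. (nrm (T (u k)))\<^sup>2) summable_on UNIV"
    by (rule summable_on_cong_neutral) (auto simp: u_def T fock_norm_eq)
  finally have summable: "summable (\<lambda>k. (nrm (T (u k)))\<^sup>2)"
    by (rule summable_on_imp_summable)
  define S where "S = (\<Sum>k. (nrm (T (u k)))\<^sup>2)"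
  have le: "real N \<le> S" for N
  proof -
    note [measurable] = fock_space_measurable[OF TH[OF unit_monomial_in_fock_space]] fock_space_measurable[OF TH[OF uH]]
    have "1 \<le> (nrm (T (unit_monomial n)))\<^sup>2" for n
    proof -
      have "1 \<le> cmod c ^ n" using c by (intro one_le_power) simp
      also have "\<dots> \<le> nrm (T (unit_monomial n))"
        unfolding T by (rule composed_unit_monomial_norm_lower) (use TH[OF unit_monomial_in_fock_space] in \<open>simp add: T\<close>)
      finally show ?thesis by (rule one_le_power)
    qed
    then have "real N \<le> (\<Sum>n<N. (nrm (T (unit_monomial n)))\<^sup>2)"
      using sum_mono[of "{..<N}" "\<lambda>_. 1::real"] by simp
    then have "ennreal (real N) \<le> (\<Sum>n<N. ennreal ((nrm (T (unit_monomial n)))\<^sup>2))"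
      by (simp add: ennreal_leI)
    also have "\<dots> = (\<integral>\<^sup>+z. (\<Sum>n<N. ennreal ((cmod (T (unit_monomial n) z))\<^sup>2)) \<partial>\<mu>)"
      by (subst nn_integral_sum) (auto simp: nn_integral_cmod_square[OF TH[OF unit_monomial_in_fock_space]])
    also have "\<dots> \<le> (\<integral>\<^sup>+z. (\<Sum>k. ennreal ((cmod (T (u k) z))\<^sup>2)) \<partial>\<mu>)"
      unfolding T
      by (intro nn_integral_mono monomial_kernel_le_basis_sum[OF u]) (rule maximal)
    also have "\<dots> = (\<Sum>k. \<integral>\<^sup>+z. ennreal ((cmod (T (u k) z))\<^sup>2) \<partial>\<mu>)"
      by (rule nn_integral_suminf) measurable
    also have "\<dots> = (\<Sum>k. ennreal ((nrm (T (u k)))\<^sup>2))"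
      by (simp add: nn_integral_cmod_square[OF TH[OF uH]])
    also have "\<dots> = ennreal S"
      unfolding S_def by (rule suminf_ennreal2) (auto simp: summable)
    finally show ?thesis
      by (subst (asm) ennreal_le_iff) (auto simp: S_def intro!: suminf_nonneg summable)
  qed
  obtain N where "S < real N" using reals_Archimedean2 by blast
  with le[of N] show False by simp
qed

end

theorem corollary5p6:
  fixes m \<alpha> :: real and \<phi> :: "complex \<Rightarrow> complex" and c :: complex
  assumes "m > 0" and "\<alpha> > 0"
    and "\<And>z. \<phi> z = \<phi> 0 + c * z"
  shows "(fock_compact_operator \<alpha> m (composition_operator \<phi>)
            \<longleftrightarrow> fock_Hilbert_Schmidt_operator \<alpha> m (composition_operator \<phi>))
       \<and> (fock_Hilbert_Schmidt_operator \<alpha> m (composition_operator \<phi>) \<longleftrightarrow> cmod c < 1)"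
proof -
  interpret fock_parameters \<alpha> m by standard (rule assms(1,2))+
  define b where "b = \<phi> 0"
  have phi: "\<phi> = (\<lambda>z. b + c * z)" unfolding b_def by (rule ext) (rule assms(3))
  have "fock_compact_operator \<alpha> m (composition_operator \<phi>) \<longleftrightarrow> cmod c < 1"
    unfolding phi by (rule iffI[OF affine_composition_compact_imp affine_composition_compact])
  moreover have "fock_Hilbert_Schmidt_operator \<alpha> m (composition_operator \<phi>) \<longleftrightarrow> cmod c < 1"
    unfolding phi by (rule iffI[OF affine_composition_Hilbert_Schmidt_imp affine_composition_Hilbert_Schmidt])
  ultimately show ?thesis by simp
qed

end
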